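(* Every nonempty simple matroid $M\in\mathcal{ME}$ has a divisional atom $e$ such that $\mathrm{si}(M/e)\in\mathcal{ME}$.
   Context: All matroids are finite. For a simple matroid $M$ on ground set $E$ with rank function $r$, flats ordered by inclusion form the lattice $L(M)$, with $X\vee Y=\mathrm{cl}(X\cup Y)$. Elements of $E$ are atoms; a coatom is a flat of rank $r(E)-1$. A flat $X$ is modular if $r(X)+r(Y)=r(X\cap Y)+r(X\vee Y)$ for all flats $Y$. $M/e$ is contraction and $\mathrm{si}$ simplification. The characteristic polynomial is $\chi(M,t)=\sum_{X\in L(M)}\mu(X)t^{r(E)-r(X)}$ with $\mu$ the Möbius function from the bottom, computed for contractions from their lattice of flats. An atom $e$ is divisional if $\chi(M/e,t)$ divides $\chi(M,t)$. A simple matroid $M$ is a modular join if $E=E_1\cup E_2$ for proper modular flats $E_1,E_2$; one writes $M=P_X(M|E_1,M|E_2)$ with $X=E_1\cap E_2$. A matroid is round if its ground set is not the union of two proper flats; a flat $S$ is round if $M|S$ is round. $\mathcal{ME}$ is the smallest class of simple matroids such that: (i) the empty matroid is in $\mathcal{ME}$; (ii) if a simple matroid $M$ has a modular coatom $X$ with $M|X\in\mathcal{ME}$, then $M\in\mathcal{ME}$; (iii) if $M$ is a modular join $P_X(M_1,M_2)$ over a round flat $X$ with $M_1,M_2\in\mathcal{ME}$, then $M\in\mathcal{ME}$. *)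

theory Defs
  imports "HOL-Computational_Algebra.Polynomial"
begin

(* Matroids are given by their rank functions (Whitney's axioms). Only the values of rk on
   subsets of the ground set are constrained or ever used; the other values are irrelevant. *)
datatype 'a matroid = Matroid (ground: "'a set") (rk: "'a set \<Rightarrow> nat")

definition matroid :: "'a matroid \<Rightarrow> bool" where
  "matroid M \<longleftrightarrow>
     finite (ground M) \<and>
     (\<forall>A. A \<subseteq> ground M \<longrightarrow> rk M A \<le> card A) \<and>
     (\<forall>A B. A \<subseteq> B \<longrightarrow> B \<subseteq> ground M \<longrightarrow> rk M A \<le> rk M B) \<and>
     (\<forall>A B. A \<subseteq> ground M \<longrightarrow> B \<subseteq> ground M \<longrightarrow>
        rk M (A \<union> B) + rk M (A \<inter> B) \<le> rk M A + rk M B)"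

definition simple_matroid :: "'a matroid \<Rightarrow> bool" where
  "simple_matroid M \<longleftrightarrow> matroid M \<and>
     (\<forall>x \<in> ground M. rk M {x} = 1) \<and>
     (\<forall>x \<in> ground M. \<forall>y \<in> ground M. x \<noteq> y \<longrightarrow> rk M {x, y} = 2)"

definition cl :: "'a matroid \<Rightarrow> 'a set \<Rightarrow> 'a set" where
  "cl M A = {x \<in> ground M. rk M (insert x A) = rk M A}"

definition flat :: "'a matroid \<Rightarrow> 'a set \<Rightarrow> bool" where
  "flat M X \<longleftrightarrow> X \<subseteq> ground M \<and> cl M X = X"

definition restrict :: "'a matroid \<Rightarrow> 'a set \<Rightarrow> 'a matroid" where
  "restrict M X = Matroid X (rk M)"

definition contract :: "'a matroid \<Rightarrow> 'a \<Rightarrow> 'a matroid" where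
  "contract M e = Matroid (ground M - {e}) (\<lambda>A. rk M (insert e A) - rk M {e})"

(* The simplification in its choice-free form: its elements are the rank-one flats, one for each
   parallel class of non-loops (together with the loops, which do not affect the rank). Choosing
   a representative of each parallel class gives an isomorphic matroid. *)
definition si :: "'a matroid \<Rightarrow> 'a set matroid" where
  "si M = Matroid {F. flat M F \<and> rk M F = 1} (\<lambda>S. rk M (\<Union>S))"

(* The Moebius function mu(0, X) of the lattice of flats, whose bottom 0 is the closure of the
   empty set. The value 0 for infinite X is a dummy that makes the recursion total. *)
function mobius :: "'a matroid \<Rightarrow> 'a set \<Rightarrow> int" where
  "mobius M X =
     (if X = cl M {} then 1
      else if finite X then - (\<Sum>Y \<in> {Y. flat M Y \<and> Y \<subset> X}. mobius M Y)
      else 0)"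
  by auto
termination
  by (relation "measure (\<lambda>(M, X). card X)") (auto intro: psubset_card_mono)

declare mobius.simps [simp del]

definition char_poly :: "'a matroid \<Rightarrow> int poly" where
  "char_poly M =
     (\<Sum>X \<in> {X. flat M X}. monom (mobius M X) (rk M (ground M) - rk M X))"

(* Divisibility is in the ring of integer polynomials; characteristic polynomials of loopless
   matroids are monic, so divisibility over the rationals would mean the same. *)
definition divisional_atom :: "'a matroid \<Rightarrow> 'a \<Rightarrow> bool" where
  "divisional_atom M e \<longleftrightarrow> e \<in> ground M \<and> char_poly (contract M e) dvd char_poly M"

definition modular_flat :: "'a matroid \<Rightarrow> 'a set \<Rightarrow> bool" where
  "modular_flat M X \<longleftrightarrow> flat M X \<and>
     (\<forall>Y. flat M Y \<longrightarrow> rk M X + rk M Y = rk M (X \<inter> Y) + rk M (cl M (X \<union> Y)))"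

definition coatom :: "'a matroid \<Rightarrow> 'a set \<Rightarrow> bool" where
  "coatom M X \<longleftrightarrow> flat M X \<and> rk M X + 1 = rk M (ground M)"

definition round_matroid :: "'a matroid \<Rightarrow> bool" where
  "round_matroid M \<longleftrightarrow>
     \<not> (\<exists>F G. flat M F \<and> flat M G \<and> F \<noteq> ground M \<and> G \<noteq> ground M \<and> F \<union> G = ground M)"

definition round_flat :: "'a matroid \<Rightarrow> 'a set \<Rightarrow> bool" where
  "round_flat M S \<longleftrightarrow> flat M S \<and> round_matroid (restrict M S)"

(* M is the modular join of its restrictions to E1 and E2, over E1 Int E2. *)
definition modular_join :: "'a matroid \<Rightarrow> 'a set \<Rightarrow> 'a set \<Rightarrow> bool" where
  "modular_join M E1 E2 \<longleftrightarrow> simple_matroid M \<and> ground M = E1 \<union> E2 \<and>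
     modular_flat M E1 \<and> E1 \<noteq> ground M \<and> modular_flat M E2 \<and> E2 \<noteq> ground M"

(* The closure rules only refer to a matroid and its own restrictions, so it is harmless that the
   class is generated separately for each type of elements. *)
inductive ME :: "'a matroid \<Rightarrow> bool" where
  empty: "simple_matroid M \<Longrightarrow> ground M = {} \<Longrightarrow> ME M"
| coatom: "simple_matroid M \<Longrightarrow> modular_flat M X \<Longrightarrow> coatom M X \<Longrightarrow>
    ME (restrict M X) \<Longrightarrow> ME M"
| join: "modular_join M E1 E2 \<Longrightarrow> round_flat M (E1 \<inter> E2) \<Longrightarrow>
    ME (restrict M E1) \<Longrightarrow> ME (restrict M E2) \<Longrightarrow> ME M"

end

(* Strengthen the claim: for every proper round flat X of M, the atom e can be chosen outside X; the
   theorem is the case where X is empty. Argue by induction on the construction of M.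

   Let M have a modular coatom Y. Projecting from a point e outside Y identifies si(M/e) with M|Y, so
   any e outside X and Y will do. If X and Y cover the ground set, then the intersection of X and Y is
   a proper round flat of M|Y, so induction gives an atom e of Y outside X. The set Y - e is a modular
   coatom of M/e, and because X is a flat avoiding e, M and si(M/e) have the same number of atoms
   outside this coatom, hence the same linear factor of the characteristic polynomial.

   Let M be a modular join over a round flat. A round X lies in one of the parts, say E2. Apply
   induction to the part E1 and the round flat common to both parts: this gives e in E1 outside E2, and
   si(M/e) is the modular join of si((M|E1)/e) and a copy of M|E2 over the same round flat.

   Divisibility follows in both cases from Stanley's modular factorization. *)

theory Submission imports Defs begin

section \<open>Rank, closure and flats\<close>

lemma rk_mono: "matroid M \<Longrightarrow> A \<subseteq> B \<Longrightarrow> B \<subseteq> ground M \<Longrightarrow> rk M A \<le> rk M B"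
  by (auto simp: matroid_def)

lemma rk_submod:
  "matroid M \<Longrightarrow> A \<subseteq> ground M \<Longrightarrow> B \<subseteq> ground M \<Longrightarrow>
    rk M (A \<union> B) + rk M (A \<inter> B) \<le> rk M A + rk M B"
  by (auto simp: matroid_def)

lemma rk_le_card: "matroid M \<Longrightarrow> A \<subseteq> ground M \<Longrightarrow> rk M A \<le> card A"
  by (auto simp: matroid_def)

lemma finite_ground: "matroid M \<Longrightarrow> finite (ground M)"
  by (auto simp: matroid_def)

lemma rk_empty [simp]: "matroid M \<Longrightarrow> rk M {} = 0"
  using rk_le_card[of M "{}"] by simp

text \<open>Monotonicity lets any common subset replace the intersection, so that later applications
  of submodularity need not compute it.\<close>

lemma rk_submod_subset:
  assumes "matroid M" "A \<subseteq> ground M" "B \<subseteq> ground M" "C \<subseteq> A" "C \<subseteq> B"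
  shows "rk M (A \<union> B) + rk M C \<le> rk M A + rk M B"
proof -
  have "rk M C \<le> rk M (A \<inter> B)"
    using assms by (intro rk_mono) auto
  then show ?thesis
    using rk_submod[of M A B] assms by linarith
qed

lemma rk_insert_le:
  assumes "matroid M" "A \<subseteq> ground M" "x \<in> ground M"
  shows "rk M (insert x A) \<le> rk M A + 1"
proof -
  have "rk M {x} \<le> 1" using rk_le_card[of M "{x}"] assms by simp
  moreover have "rk M (A \<union> {x}) + rk M {} \<le> rk M A + rk M {x}"
    using assms by (intro rk_submod_subset) auto
  ultimately show ?thesis by simp
qed

lemma simple_matroidD:
  assumes "simple_matroid M"
  shows "matroid M" "x \<in> ground M \<Longrightarrow> rk M {x} = 1"
    "x \<in> ground M \<Longrightarrow> y \<in> ground M \<Longrightarrow> x \<noteq> y \<Longrightarrow> rk M {x, y} = 2"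
  using assms by (auto simp: simple_matroid_def)

lemma cl_subset_ground: "cl M A \<subseteq> ground M"
  by (auto simp: cl_def)

lemma subset_cl: "A \<subseteq> ground M \<Longrightarrow> A \<subseteq> cl M A"
  by (auto simp: cl_def insert_absorb)

text \<open>By submodularity, adding \<open>x\<close> to the larger set \<open>B\<close> raises the
  rank by at most as much as adding it to \<open>A\<close>.\<close>

lemma cl_mono:
  assumes "matroid M" "A \<subseteq> B" "B \<subseteq> ground M"
  shows "cl M A \<subseteq> cl M B"
proof
  fix x assume "x \<in> cl M A"
  then have x: "x \<in> ground M" "rk M (insert x A) = rk M A" by (auto simp: cl_def)
  have "rk M (insert x A \<union> B) + rk M A \<le> rk M (insert x A) + rk M B"
    using assms x by (intro rk_submod_subset) auto
  moreover have "insert x A \<union> B = insert x B" using assms by auto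
  moreover have "rk M B \<le> rk M (insert x B)" using assms x by (intro rk_mono) auto
  ultimately show "x \<in> cl M B" using x by (simp add: cl_def)
qed

lemma rk_Un_subset_cl:
  assumes M: "matroid M" and A: "A \<subseteq> ground M" and B: "B \<subseteq> cl M A"
  shows "rk M (A \<union> B) = rk M A"
proof -
  have "finite B" using B cl_subset_ground finite_ground[OF M] by (metis finite_subset)
  then show ?thesis using B
  proof (induction B)
    case (insert x B)
    have sub: "A \<union> B \<subseteq> ground M" using A insert.prems cl_subset_ground by fastforce
    have "x \<in> cl M (A \<union> B)" using cl_mono[OF M _ sub, of A] insert.prems by auto
    then show ?case using insert by (simp add: cl_def)
  qed simp
qed

lemma rk_between_cl:
  assumes "matroid M" "A \<subseteq> ground M" "A \<subseteq> B" "B \<subseteq> cl M A"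
  shows "rk M B = rk M A"
  using rk_Un_subset_cl[of M A B] assms by (simp add: Un_absorb1)

lemma rk_cl: "matroid M \<Longrightarrow> A \<subseteq> ground M \<Longrightarrow> rk M (cl M A) = rk M A"
  by (rule rk_between_cl) (auto simp: subset_cl)

lemma flat_subset: "flat M X \<Longrightarrow> X \<subseteq> ground M"
  by (simp add: flat_def)

lemma flatI:
  assumes "X \<subseteq> ground M" "\<And>x. x \<in> ground M \<Longrightarrow> rk M (insert x X) = rk M X \<Longrightarrow> x \<in> X"
  shows "flat M X"
  using assms subset_cl[of X M] by (auto simp: flat_def cl_def)

lemma flatD: "flat M X \<Longrightarrow> x \<in> ground M \<Longrightarrow> rk M (insert x X) = rk M X \<Longrightarrow> x \<in> X"
  by (auto simp: flat_def cl_def)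

lemma flat_cl:
  assumes M: "matroid M" and A: "A \<subseteq> ground M"
  shows "flat M (cl M A)"
proof (rule flatI[OF cl_subset_ground])
  fix x assume x: "x \<in> ground M" "rk M (insert x (cl M A)) = rk M (cl M A)"
  have "rk M (insert x A) \<le> rk M (insert x (cl M A))"
    using x cl_subset_ground[of M A] subset_cl[OF A] by (intro rk_mono[OF M]) auto
  moreover have "rk M A \<le> rk M (insert x A)" using x A by (intro rk_mono[OF M]) auto
  ultimately show "x \<in> cl M A" using x rk_cl[OF M A] by (simp add: cl_def)
qed

lemma cl_subset_flat: "matroid M \<Longrightarrow> flat M F \<Longrightarrow> A \<subseteq> F \<Longrightarrow> cl M A \<subseteq> F"
  using cl_mono[of M A F] by (simp add: flat_def)

lemma cl_subset_flat_iff: "matroid M \<Longrightarrow> flat M F \<Longrightarrow> A \<subseteq> ground M \<Longrightarrow> cl M A \<subseteq> F \<longleftrightarrow> A \<subseteq> F"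
  using cl_subset_flat[of M F A] subset_cl[of A M] by blast

lemma flat_ground: "flat M (ground M)"
  by (rule flatI) auto

lemma flat_Int:
  assumes "matroid M" "flat M F" "flat M G"
  shows "flat M (F \<inter> G)"
proof (rule flatI)
  show "F \<inter> G \<subseteq> ground M" using assms flat_subset by blast
  fix x assume "x \<in> ground M" "rk M (insert x (F \<inter> G)) = rk M (F \<inter> G)"
  then have "x \<in> cl M (F \<inter> G)" by (simp add: cl_def)
  then show "x \<in> F \<inter> G" using cl_subset_flat[of M _ "F \<inter> G"] assms by blast
qed

lemma rk_insert_flat:
  assumes "matroid M" "flat M F" "x \<in> ground M" "x \<notin> F"
  shows "rk M (insert x F) = rk M F + 1"
proof -
  have "rk M F \<le> rk M (insert x F)" using assms flat_subset by (intro rk_mono) auto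
  then show ?thesis
    using rk_insert_le[of M F x] flatD[of M F x] flat_subset[of M F] assms by fastforce
qed

text \<open>The gain from \<open>x\<close> can only grow on passing from the flat \<open>F\<close>
  to a subset of it. Over \<open>F\<close> it is already 1, the largest possible value.\<close>

lemma rk_insert_subset_flat:
  assumes "matroid M" "flat M F" "x \<in> ground M" "x \<notin> F" "A \<subseteq> F"
  shows "rk M (insert x A) = rk M A + 1"
proof -
  have F: "F \<subseteq> ground M" using assms flat_subset by auto
  have "rk M (insert x A \<union> F) + rk M A \<le> rk M (insert x A) + rk M F"
    using assms F by (intro rk_submod_subset) auto
  moreover have "insert x A \<union> F = insert x F" using assms by auto
  ultimately show ?thesis
    using rk_insert_flat[OF assms(1-4)] rk_insert_le[of M A x] assms F by fastforce
qed

lemma rk_flat_strict: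
  assumes "matroid M" "flat M F" "F \<subset> G" "G \<subseteq> ground M"
  shows "rk M F < rk M G"
proof -
  obtain x where "x \<in> G" "x \<notin> F" using assms by blast
  then have "rk M F + 1 = rk M (insert x F)" using rk_insert_flat[of M F x] assms by auto
  also have "\<dots> \<le> rk M G" using assms \<open>x \<in> G\<close> by (intro rk_mono) auto
  finally show ?thesis by simp
qed

lemma flat_eqI:
  assumes "matroid M" "flat M F" "F \<subseteq> G" "G \<subseteq> ground M" "rk M G \<le> rk M F"
  shows "F = G"
  using rk_flat_strict[of M F G] assms by force

lemma cl_empty_subset: "matroid M \<Longrightarrow> flat M F \<Longrightarrow> cl M {} \<subseteq> F"
  by (rule cl_subset_flat) auto

lemma simple_cl_empty [simp]: "simple_matroid M \<Longrightarrow> cl M {} = {}"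
  by (auto simp: cl_def simple_matroid_def)

lemma simple_flat_singleton:
  assumes "simple_matroid M" "x \<in> ground M"
  shows "flat M {x}"
proof (rule flatI)
  fix y assume "y \<in> ground M" "rk M {y, x} = rk M {x}"
  then show "y \<in> {x}"
    using simple_matroidD(2)[of M x] simple_matroidD(3)[of M y x] assms by force
qed (use assms in auto)

lemma finite_flats: "matroid M \<Longrightarrow> finite {F. flat M F \<and> P F}"
  by (rule finite_subset[of _ "Pow (ground M)"]) (auto simp: finite_ground flat_def)

section \<open>Restrictions and modular flats\<close>

lemma ground_restrict [simp]: "ground (restrict M X) = X"
  and rk_restrict [simp]: "rk (restrict M X) = rk M"
  and restrict_restrict [simp]: "restrict (restrict M X) Y = restrict M Y"
  by (auto simp: restrict_def)

lemma matroid_restrict: "matroid M \<Longrightarrow> X \<subseteq> ground M \<Longrightarrow> matroid (restrict M X)"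
  by (auto simp: matroid_def intro: finite_subset)

lemma simple_restrict: "simple_matroid M \<Longrightarrow> X \<subseteq> ground M \<Longrightarrow> simple_matroid (restrict M X)"
  using matroid_restrict[of M X] by (auto simp: simple_matroid_def subset_iff)

text \<open>Since \<open>X\<close> is closed, subsets of \<open>X\<close> have the same closure in
  the restriction as in \<open>M\<close>.\<close>

lemma flat_restrict_iff:
  assumes "matroid M" "flat M X"
  shows "flat (restrict M X) F \<longleftrightarrow> flat M F \<and> F \<subseteq> X"
proof -
  have "cl (restrict M X) F = cl M F" if "F \<subseteq> X"
    using cl_subset_flat[OF assms that] flat_subset[OF assms(2)]
    by (auto simp: cl_def)
  then show ?thesis using flat_subset[OF assms(2)] by (auto simp: flat_def)
qed

lemma flat_restrict: "matroid M \<Longrightarrow> flat M F \<Longrightarrow> flat M X \<Longrightarrow> flat (restrict M X) (F \<inter> X)"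
  by (simp add: flat_restrict_iff flat_Int)

text \<open>The reverse inequality is submodularity, and taking the closure of a union does not
  change its rank.\<close>

lemma modular_flat_iff:
  assumes M: "matroid M"
  shows "modular_flat M X \<longleftrightarrow>
    flat M X \<and> (\<forall>Y. flat M Y \<longrightarrow> rk M X + rk M Y \<le> rk M (X \<inter> Y) + rk M (X \<union> Y))"
proof -
  have "rk M (cl M (X \<union> Y)) = rk M (X \<union> Y)" if "flat M X" "flat M Y" for Y
    using that M by (intro rk_cl) (auto simp: flat_def)
  moreover have "rk M (X \<union> Y) + rk M (X \<inter> Y) \<le> rk M X + rk M Y" if "flat M X" "flat M Y" for Y
    using that M by (intro rk_submod) (auto simp: flat_def)
  ultimately show ?thesis unfolding modular_flat_def by (smt (verit, best) add.commute le_antisym order.refl)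
qed

lemma modular_flatD:
  assumes "matroid M" "modular_flat M X"
  shows "flat M X" "flat M Y \<Longrightarrow> rk M X + rk M Y = rk M (X \<inter> Y) + rk M (X \<union> Y)"
proof -
  show X: "flat M X" using assms by (simp add: modular_flat_def)
  assume Y: "flat M Y"
  have "rk M (X \<union> Y) + rk M (X \<inter> Y) \<le> rk M X + rk M Y"
    using X Y assms by (intro rk_submod) (auto simp: flat_def)
  then show "rk M X + rk M Y = rk M (X \<inter> Y) + rk M (X \<union> Y)"
    using modular_flat_iff[of M X] assms Y by force
qed

text \<open>Submodularity for \<open>X\<close> and \<open>(X \<inter> E) \<union> Y\<close>, which
  share \<open>X \<inter> E\<close>, bounds the rank of \<open>X \<union> Y\<close>. Inserting this
  into the modular equation for \<open>X\<close> and \<open>Y\<close> leaves the inequality for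
  \<open>X \<inter> E\<close>.\<close>

lemma modular_restrict:
  assumes M: "matroid M" and X: "modular_flat M X" and E: "flat M E"
  shows "modular_flat (restrict M E) (X \<inter> E)"
proof -
  have sub: "E \<subseteq> ground M" "X \<subseteq> ground M" using E X M flat_subset modular_flatD by blast+
  have "rk M (X \<inter> E) + rk M Y \<le> rk M (X \<inter> E \<inter> Y) + rk M (X \<inter> E \<union> Y)"
    if Y: "flat M Y" "Y \<subseteq> E" for Y
  proof -
    have "rk M (X \<union> (X \<inter> E \<union> Y)) + rk M (X \<inter> E) \<le> rk M X + rk M (X \<inter> E \<union> Y)"
      using sub Y by (intro rk_submod_subset[OF M]) auto
    moreover have "X \<union> (X \<inter> E \<union> Y) = X \<union> Y" "X \<inter> E \<inter> Y = X \<inter> Y" using Y by auto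
    ultimately show ?thesis using modular_flatD(2)[OF M X Y(1)] by simp
  qed
  then show ?thesis
    using modular_flatD(1)[OF M X] E
    by (auto simp: modular_flat_iff matroid_restrict M sub flat_restrict_iff flat_Int)
qed

text \<open>The line through \<open>e\<close> and \<open>x\<close> has rank 2, but joining it to
  \<open>Y\<close> raises the rank by at most 1. By modularity it meets \<open>Y\<close>, and a
  common point serves as \<open>g\<close>. This is projection from \<open>e\<close> onto
  \<open>Y\<close>.\<close>

lemma modular_flat_line:
  assumes S: "simple_matroid M" and Y: "modular_flat M Y" and e: "e \<in> ground M" "e \<notin> Y"
    and x: "x \<in> ground M" "x \<noteq> e" "rk M (insert x (insert e Y)) = rk M Y + 1"
  shows "\<exists>g\<in>Y. rk M {e, g, x} = 2"
proof -
  note M = simple_matroidD(1)[OF S]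
  let ?L = "cl M {e, x}"
  have L: "flat M ?L" "rk M ?L = 2"
    using flat_cl[OF M, of "{e,x}"] rk_cl[OF M, of "{e,x}"] simple_matroidD(3)[OF S e(1) x(1)] e x by auto
  have Ysub: "Y \<subseteq> ground M" using Y flat_subset modular_flatD[OF M] by blast
  have "Y \<union> {e,x} \<subseteq> ground M" using Ysub e x by auto
  then have "?L \<subseteq> cl M (Y \<union> {e,x})" by (intro cl_mono[OF M]) auto
  then have "rk M (Y \<union> ?L) \<le> rk M (cl M (Y \<union> {e,x}))"
    using subset_cl[of "Y \<union> {e,x}" M] \<open>Y \<union> {e,x} \<subseteq> ground M\<close> by (intro rk_mono[OF M] cl_subset_ground) auto
  also have "\<dots> = rk M Y + 1" using rk_cl[OF M \<open>Y \<union> {e,x} \<subseteq> ground M\<close>] x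
    by (simp add: insert_commute)
  finally have "rk M (Y \<inter> ?L) \<ge> 1" using modular_flatD(2)[OF M Y L(1)] L(2) by linarith
  then have "Y \<inter> ?L \<noteq> {}" using M by auto
  then obtain g where g: "g \<in> Y" "g \<in> ?L" by blast
  have "rk M {e, g, x} = rk M {e, x}"
    using g e x subset_cl[of "{e,x}" M] by (intro rk_between_cl[OF M]) auto
  then show ?thesis using g simple_matroidD(3)[OF S e(1) x(1)] x by auto
qed

subsection \<open>The Moebius function and modular factorization\<close>

lemma mobius_cl_empty [simp]: "mobius M (cl M {}) = 1"
  by (subst mobius.simps) simp

lemma sum_mobius:
  assumes M: "matroid M" and X: "flat M X"
  shows "(\<Sum>Y | flat M Y \<and> Y \<subseteq> X. mobius M Y) = (if X = cl M {} then 1 else 0)"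
proof (cases "X = cl M {}")
  case True
  then have "{Y. flat M Y \<and> Y \<subseteq> X} = {X}" using cl_empty_subset[OF M] X by auto
  then show ?thesis using True by simp
next
  case False
  have "{Y. flat M Y \<and> Y \<subseteq> X} = insert X {Y. flat M Y \<and> Y \<subset> X}" using X by auto
  moreover have "finite X" using flat_subset[OF X] finite_ground[OF M] finite_subset by blast
  ultimately show ?thesis
    using False by (simp add: mobius.simps[of M X] finite_flats[OF M])
qed

text \<open>Induction over the flats, solving each equation for its top term. Later identities for
  \<open>mobius\<close> reduce to checking these sums instead of unfolding the recursion.\<close>

lemma mobius_unique:
  assumes M: "matroid M"
    and g: "\<And>X. flat M X \<Longrightarrow> (\<Sum>Y | flat M Y \<and> Y \<subseteq> X. g Y) = (if X = cl M {} then 1 else 0)"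
    and X: "flat M X"
  shows "g X = mobius M X"
proof -
  have "finite X" using flat_subset[OF X] finite_ground[OF M] finite_subset by blast
  then show ?thesis using X
  proof (induction X rule: finite_psubset_induct)
    case (psubset X)
    have eq: "{Y. flat M Y \<and> Y \<subseteq> X} = insert X {Y. flat M Y \<and> Y \<subset> X}" using psubset.prems by auto
    have "(\<Sum>Y | flat M Y \<and> Y \<subset> X. g Y) = (\<Sum>Y | flat M Y \<and> Y \<subset> X. mobius M Y)"
      using psubset.IH by (intro sum.cong) auto
    moreover have "(\<Sum>Y | flat M Y \<and> Y \<subseteq> X. g Y) = (\<Sum>Y | flat M Y \<and> Y \<subseteq> X. mobius M Y)"
      using g[OF psubset.prems] sum_mobius[OF M psubset.prems] by simp
    ultimately show ?case by (simp add: eq finite_flats[OF M])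
  qed
qed

text \<open>The flats below \<open>F\<close> are the same in \<open>M\<close> and in the
  restriction, so \<open>mobius M\<close> satisfies the defining sums of the restriction.\<close>

lemma mobius_restrict:
  assumes M: "matroid M" and X: "flat M X" and F: "flat M F" "F \<subseteq> X"
  shows "mobius (restrict M X) F = mobius M F"
proof -
  note R = matroid_restrict[OF M flat_subset[OF X]]
  have "cl (restrict M X) {} = cl M {}"
    using cl_empty_subset[OF M X] flat_subset[OF X] by (auto simp: cl_def)
  moreover have "{Y. flat (restrict M X) Y \<and> Y \<subseteq> Z} = {Y. flat M Y \<and> Y \<subseteq> Z}" if "Z \<subseteq> X" for Z
    using that by (auto simp: flat_restrict_iff[OF M X])
  ultimately show ?thesis
    using F by (intro mobius_unique[OF R, symmetric]) (auto simp: flat_restrict_iff[OF M X] sum_mobius[OF M])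
qed

lemma char_poly_restrict:
  assumes "matroid M" "flat M X"
  shows "char_poly (restrict M X) =
    (\<Sum>F | flat M F \<and> F \<subseteq> X. monom (mobius M F) (rk M X - rk M F))"
  unfolding char_poly_def
  by (rule sum.cong) (auto simp: flat_restrict_iff assms mobius_restrict)

text \<open>The coefficient in degree \<open>rk M (ground M)\<close> is 1, because the bottom is the
  only flat of rank 0. This permits cancelling characteristic polynomials.\<close>

lemma char_poly_nonzero:
  assumes M: "matroid M"
  shows "char_poly M \<noteq> 0"
proof -
  have 0: "flat M (cl M {})" "rk M (cl M {}) = 0"
    using flat_cl[OF M, of "{}"] rk_cl[OF M, of "{}"] M by auto
  have "coeff (char_poly M) (rk M (ground M)) =
    (\<Sum>F | flat M F. if rk M (ground M) - rk M F = rk M (ground M) then mobius M F else 0)"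
    by (simp add: char_poly_def coeff_sum)
  also have "\<dots> = (\<Sum>F | flat M F. if F = cl M {} then 1 else 0)"
  proof (rule sum.cong)
    fix F assume "F \<in> {F. flat M F}"
    then have F: "flat M F" by simp
    \<comment> \<open>Subtraction is truncated, so the test \<open>r - k = r\<close> also succeeds
      for \<open>r = 0\<close>. The bound ensures that it detects only rank 0.\<close>
    have le: "rk M F \<le> rk M (ground M)" using F by (intro rk_mono[OF M]) (auto simp: flat_def)
    show "(if rk M (ground M) - rk M F = rk M (ground M) then mobius M F else 0) =
      (if F = cl M {} then 1 else 0)"
    proof (cases "F = cl M {}")
      case True
      then show ?thesis using 0 by simp
    next
      case False
      then have "rk M (cl M {}) < rk M F"
        using cl_empty_subset[OF M F] F by (intro rk_flat_strict[OF M 0(1)]) (auto simp: flat_def)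
      then show ?thesis using False le by auto
    qed
  qed simp
  also have "\<dots> = 1" using 0 finite_flats[OF M, of "\<lambda>_. True"] by simp
  finally show ?thesis by auto
qed

text \<open>Modularity makes the ranks of \<open>X\<close> and \<open>Y\<close> add up.
  Submodularity passes this additivity on to every subset \<open>A\<close> of
  \<open>X\<close>.\<close>

lemma modular_rk_Un:
  assumes M: "matroid M" and X: "modular_flat M X" and A: "A \<subseteq> X"
    and Y: "flat M Y" "X \<inter> Y = cl M {}"
  shows "rk M (A \<union> Y) = rk M A + rk M Y"
proof -
  have sub: "X \<subseteq> ground M" "Y \<subseteq> ground M" using X Y flat_subset modular_flatD[OF M] by blast+
  have "rk M (X \<union> Y) = rk M X + rk M Y"
    using modular_flatD(2)[OF M X Y(1)] Y rk_cl[OF M, of "{}"] M by simp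
  moreover have "rk M (X \<union> (A \<union> Y)) + rk M A \<le> rk M X + rk M (A \<union> Y)"
    using sub A by (intro rk_submod_subset[OF M]) auto
  moreover have "X \<union> (A \<union> Y) = X \<union> Y" using A by auto
  moreover have "rk M (A \<union> Y) + rk M {} \<le> rk M A + rk M Y"
    using sub A by (intro rk_submod_subset[OF M]) auto
  ultimately show ?thesis by simp
qed

text \<open>The right-hand side satisfies the defining recursion of the left-hand side: summed over all
  flats below \<open>W\<close>, it factors into a sum over the flats below \<open>X \<inter> W\<close>, which vanishes unless this
  is the bottom, and a sum over the flats \<open>Y \<le> W\<close>.\<close>

lemma mobius_convolution:
  assumes M: "matroid M" and X: "flat M X" and Z: "flat M Z"
  shows "mobius M Z = (\<Sum>(A, Y) | flat M A \<and> A \<subseteq> X \<and> flat M Y \<and> X \<inter> Y = cl M {} \<and> cl M (A \<union> Y) = Z.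
    mobius M A * mobius M Y)"
proof -
  define P where "P = {A. flat M A \<and> A \<subseteq> X}"
  define Q where "Q = {Y. flat M Y \<and> X \<inter> Y = cl M {}}"
  have fin: "finite P" "finite Q" by (simp_all add: P_def Q_def finite_flats[OF M])
  define \<nu> where "\<nu> Z = (\<Sum>(A, Y) | (A, Y) \<in> P \<times> Q \<and> cl M (A \<union> Y) = Z. mobius M A * mobius M Y)" for Z
  have "(\<Sum>Z | flat M Z \<and> Z \<subseteq> W. \<nu> Z) = (if W = cl M {} then 1 else 0)" if W: "flat M W" for W
  proof -
    let ?S = "{A\<in>P. A \<subseteq> W} \<times> {Y\<in>Q. Y \<subseteq> W}"
    \<comment> \<open>A join is below \<open>W\<close> exactly when both of its members are, so the
      sum over \<open>Z\<close> can be regrouped as a sum over a product of two sets.\<close>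
    have iff: "flat M (cl M (A \<union> Y)) \<and> (cl M (A \<union> Y) \<subseteq> W \<longleftrightarrow> A \<subseteq> W \<and> Y \<subseteq> W)" if "A \<in> P" "Y \<in> Q" for A Y
    proof -
      have "A \<union> Y \<subseteq> ground M" using that by (auto simp: P_def Q_def flat_def)
      then show ?thesis using flat_cl[OF M] cl_subset_flat_iff[OF M W] by auto
    qed
    have "(\<Sum>Z | flat M Z \<and> Z \<subseteq> W. \<nu> Z) =
      (\<Sum>Z | flat M Z \<and> Z \<subseteq> W. \<Sum>p | p \<in> ?S \<and> (case p of (A, Y) \<Rightarrow> cl M (A \<union> Y)) = Z.
        case p of (A, Y) \<Rightarrow> mobius M A * mobius M Y)"
    proof (unfold \<nu>_def, intro sum.cong refl)
      fix Z assume "Z \<in> {Z. flat M Z \<and> Z \<subseteq> W}"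
      then have "A \<subseteq> W \<and> Y \<subseteq> W" if "A \<in> P" "Y \<in> Q" "cl M (A \<union> Y) = Z" for A Y
        using iff[OF that(1,2)] that(3) by simp
      then show "{(A, Y). (A, Y) \<in> P \<times> Q \<and> cl M (A \<union> Y) = Z} =
        {p. p \<in> ?S \<and> (case p of (A, Y) \<Rightarrow> cl M (A \<union> Y)) = Z}" by blast
    qed
    also have "\<dots> = (\<Sum>(A, Y)\<in>?S. mobius M A * mobius M Y)"
    proof (intro sum.group finite_flats[OF M])
      show "finite ?S" using fin by simp
      show "(\<lambda>(A, Y). cl M (A \<union> Y)) ` ?S \<subseteq> {Z. flat M Z \<and> Z \<subseteq> W}"
        by clarify (simp add: iff)
    qed
    also have "\<dots> = (\<Sum>A\<in>{A\<in>P. A \<subseteq> W}. mobius M A) * (\<Sum>Y\<in>{Y\<in>Q. Y \<subseteq> W}. mobius M Y)"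
      by (simp add: sum_product sum.cartesian_product)
    also have "{A\<in>P. A \<subseteq> W} = {A. flat M A \<and> A \<subseteq> X \<inter> W}" by (auto simp: P_def)
    also have "(\<Sum>A\<in>\<dots>. mobius M A) = (if X \<inter> W = cl M {} then 1 else 0)"
      by (rule sum_mobius[OF M flat_Int[OF M X W]])
    also have "\<dots> * (\<Sum>Y\<in>{Y\<in>Q. Y \<subseteq> W}. mobius M Y) = (if W = cl M {} then 1 else 0)"
    proof (cases "X \<inter> W = cl M {}")
      case True
      \<comment> \<open>Every flat below \<open>W\<close> now meets \<open>X\<close> in the bottom,
        so the condition defining \<open>Q\<close> holds automatically.\<close>
      then have "{Y\<in>Q. Y \<subseteq> W} = {Y. flat M Y \<and> Y \<subseteq> W}"
        using cl_empty_subset[OF M] X by (auto simp: Q_def)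
      then show ?thesis using True sum_mobius[OF M W] by simp
    next
      case False
      then have "W \<noteq> cl M {}" using cl_empty_subset[OF M X] by auto
      with False show ?thesis by simp
    qed
    finally show ?thesis .
  qed
  from mobius_unique[OF M this Z] show ?thesis
    by (simp add: \<nu>_def P_def Q_def conj_ac)
qed

section \<open>Characteristic polynomials and modular flats\<close>

lemma monom_sum: "monom (\<Sum>i\<in>I. f i) n = (\<Sum>i\<in>I. monom (f i) n)"
  by (rule poly_eqI) (simp add: coeff_sum)

text \<open>Stanley's factorization. Sorting flats by their decomposition into joins of
  \<open>A\<close> and \<open>Y\<close> turns the Moebius convolution into a product, because
  modularity makes the rank of each such join the sum of the two ranks.\<close>

lemma char_poly_modular_factor:
  assumes M: "matroid M" and X: "modular_flat M X"
  shows "char_poly M = char_poly (restrict M X) *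
    (\<Sum>Y | flat M Y \<and> X \<inter> Y = cl M {}. monom (mobius M Y) (rk M (ground M) - rk M X - rk M Y))"
proof -
  note FX = modular_flatD(1)[OF M X]
  define P where "P = {A. flat M A \<and> A \<subseteq> X}"
  define Q where "Q = {Y. flat M Y \<and> X \<inter> Y = cl M {}}"
  have fin: "finite P" "finite Q" by (simp_all add: P_def Q_def finite_flats[OF M])
  let ?r = "rk M (ground M)"
  have "char_poly M = (\<Sum>Z | flat M Z. \<Sum>p | p \<in> P \<times> Q \<and> (case p of (A, Y) \<Rightarrow> cl M (A \<union> Y)) = Z.
      case p of (A, Y) \<Rightarrow> monom (mobius M A * mobius M Y) (?r - rk M (cl M (A \<union> Y))))"
    unfolding char_poly_def
  proof (rule sum.cong)
    fix Z assume "Z \<in> {Z. flat M Z}"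
    then have "mobius M Z = (\<Sum>(A, Y) | flat M A \<and> A \<subseteq> X \<and> flat M Y \<and> X \<inter> Y = cl M {} \<and> cl M (A \<union> Y) = Z.
      mobius M A * mobius M Y)" using mobius_convolution[OF M FX] by simp
    also have "{(A, Y). flat M A \<and> A \<subseteq> X \<and> flat M Y \<and> X \<inter> Y = cl M {} \<and> cl M (A \<union> Y) = Z} =
      {p. p \<in> P \<times> Q \<and> (case p of (A, Y) \<Rightarrow> cl M (A \<union> Y)) = Z}" by (auto simp: P_def Q_def)
    finally show "monom (mobius M Z) (?r - rk M Z) =
      (\<Sum>p | p \<in> P \<times> Q \<and> (case p of (A, Y) \<Rightarrow> cl M (A \<union> Y)) = Z.
      case p of (A, Y) \<Rightarrow> monom (mobius M A * mobius M Y) (?r - rk M (cl M (A \<union> Y))))"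
      by (auto simp: monom_sum intro!: sum.cong)
  qed simp
  also have "\<dots> = (\<Sum>(A, Y)\<in>P \<times> Q. monom (mobius M A * mobius M Y) (?r - rk M (cl M (A \<union> Y))))"
  proof (rule sum.group)
    show "finite {Z. flat M Z}" using finite_flats[OF M, of "\<lambda>_. True"] by simp
    show "(\<lambda>p. case p of (A, Y) \<Rightarrow> cl M (A \<union> Y)) ` (P \<times> Q) \<subseteq> {Z. flat M Z}"
      by clarify (auto simp: P_def Q_def intro!: flat_cl[OF M] dest: flat_subset)
  qed (use fin in simp)
  also have "\<dots> = (\<Sum>(A, Y)\<in>P \<times> Q. monom (mobius M A) (rk M X - rk M A) *
      monom (mobius M Y) (?r - rk M X - rk M Y))"
  proof (intro sum.cong refl, clarify)
    fix A Y assume "A \<in> P" "Y \<in> Q"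
    then have AY: "flat M A" "A \<subseteq> X" "flat M Y" "X \<inter> Y = cl M {}" by (auto simp: P_def Q_def)
    have sub: "A \<union> Y \<subseteq> ground M" "X \<union> Y \<subseteq> ground M" using AY FX by (auto simp: flat_def)
    have "rk M (X \<union> Y) = rk M X + rk M Y" "rk M (cl M (A \<union> Y)) = rk M A + rk M Y"
      using modular_rk_Un[OF M X _ AY(3,4)] AY rk_cl[OF M sub(1)] by auto
    \<comment> \<open>These bounds make the truncated subtractions exact, so the exponent splits
      into the exponents of the two monomials.\<close>
    moreover have "rk M (X \<union> Y) \<le> ?r" "rk M A \<le> rk M X"
      using AY sub FX by (auto intro!: rk_mono[OF M] simp: flat_def)
    ultimately show "monom (mobius M A * mobius M Y) (?r - rk M (cl M (A \<union> Y))) =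
      monom (mobius M A) (rk M X - rk M A) * monom (mobius M Y) (?r - rk M X - rk M Y)"
      by (simp add: mult_monom)
  qed
  also have "\<dots> = char_poly (restrict M X) * (\<Sum>Y\<in>Q. monom (mobius M Y) (?r - rk M X - rk M Y))"
    by (simp add: char_poly_restrict[OF M FX] P_def[symmetric] sum_product sum.cartesian_product)
  finally show ?thesis by (simp add: Q_def)
qed

text \<open>A flat meeting \<open>E1\<close> only in the bottom lies in \<open>E2\<close>. Hence the
  cofactor of \<open>E1\<close> in \<open>M\<close> equals the cofactor of
  \<open>E1 \<inter> E2\<close> in \<open>restrict M E2\<close>, and comparing the two
  factorizations gives the identity.\<close>

lemma char_poly_modular_Un:
  assumes M: "matroid M" and E: "modular_flat M E1" "modular_flat M E2" "ground M = E1 \<union> E2"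
  shows "char_poly M * char_poly (restrict M (E1 \<inter> E2)) =
    char_poly (restrict M E1) * char_poly (restrict M E2)"
proof -
  note F = modular_flatD(1)[OF M E(1)] modular_flatD(1)[OF M E(2)]
  let ?N = "restrict M E2"
  have N: "matroid ?N" "modular_flat ?N (E1 \<inter> E2)"
    using matroid_restrict[OF M] modular_restrict[OF M E(1) F(2)] E by auto
  have cl: "cl ?N {} = cl M {}"
    using cl_empty_subset[OF M F(2)] E by (auto simp: cl_def)
  have eq: "{Y. flat ?N Y \<and> E1 \<inter> E2 \<inter> Y = cl ?N {}} = {Y. flat M Y \<and> E1 \<inter> Y = cl M {}}"
  proof -
    have "Y \<subseteq> E2" if "flat M Y" "E1 \<inter> Y = cl M {}" for Y
      using that cl_empty_subset[OF M F(2)] E flat_subset[of M Y] by blast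
    then show ?thesis by (auto simp: flat_restrict_iff[OF M F(2)] cl)
  qed
  have "rk M (ground M) - rk M E1 = rk M E2 - rk M (E1 \<inter> E2)"
    using modular_flatD(2)[OF M E(1) F(2)] rk_mono[OF M, of "E1 \<inter> E2" E2] E by simp
  then have "(\<Sum>Y | flat M Y \<and> E1 \<inter> Y = cl M {}. monom (mobius M Y) (rk M (ground M) - rk M E1 - rk M Y)) =
    (\<Sum>Y | flat ?N Y \<and> E1 \<inter> E2 \<inter> Y = cl ?N {}. monom (mobius ?N Y) (rk ?N (ground ?N) - rk ?N (E1 \<inter> E2) - rk ?N Y))"
    unfolding eq[symmetric]
    by (intro sum.cong) (auto simp: flat_restrict_iff[OF M F(2)] mobius_restrict[OF M F(2)])
  then show ?thesis
    using char_poly_modular_factor[OF M E(1)] char_poly_modular_factor[OF N] by simp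
qed

text \<open>By modularity a flat disjoint from the coatom has rank at most 1. The cofactor thus sums
  over the empty flat and the atoms outside \<open>X\<close>, whose Moebius values are 1 and
  -1.\<close>

lemma char_poly_modular_coatom:
  assumes S: "simple_matroid M" and X: "modular_flat M X" "coatom M X"
  shows "char_poly M = char_poly (restrict M X) * [:- int (card (ground M - X)), 1:]"
proof -
  note M = simple_matroidD(1)[OF S]
  have FX: "flat M X" "X \<subseteq> ground M" and r: "rk M (ground M) = rk M X + 1"
    using X by (auto simp: coatom_def flat_def)
  let ?A = "(\<lambda>x. {x}) ` (ground M - X)"
  have eq: "{Y. flat M Y \<and> X \<inter> Y = cl M {}} = insert {} ?A"
  proof (intro equalityI subsetI)
    fix Y assume "Y \<in> {Y. flat M Y \<and> X \<inter> Y = cl M {}}"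
    then have Y: "flat M Y" "X \<inter> Y = {}" "Y \<subseteq> ground M" using S by (auto simp: flat_def)
    have "rk M (X \<union> Y) \<le> rk M (ground M)" using Y FX by (intro rk_mono[OF M]) auto
    then have le: "rk M Y \<le> 1" using modular_flatD(2)[OF M X(1) Y(1)] Y r M by simp
    show "Y \<in> insert {} ?A"
    proof (cases "Y = {}")
      case False
      then obtain y where y: "y \<in> Y" by auto
      have "{y} = Y"
        using simple_flat_singleton[OF S] simple_matroidD(2)[OF S] y Y le by (intro flat_eqI[OF M]) auto
      then show ?thesis using y Y by auto
    qed simp
  next
    fix Y assume "Y \<in> insert {} ?A"
    then show "Y \<in> {Y. flat M Y \<and> X \<inter> Y = cl M {}}"
      using flat_cl[OF M, of "{}"] simple_flat_singleton[OF S] S by auto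
  qed
  have mu0: "mobius M {} = 1" using mobius_cl_empty[of M] S by simp
  have mu1: "mobius M {x} = - 1" if "x \<in> ground M" for x
  proof -
    have "{Y. flat M Y \<and> Y \<subset> {x}} = {{}}" using flat_cl[OF M, of "{}"] S by auto
    then show ?thesis using S mu0 by (simp add: mobius.simps[of M "{x}"])
  qed
  have "(\<Sum>Y\<in>insert {} ?A. monom (mobius M Y) (rk M (ground M) - rk M X - rk M Y)) =
    monom 1 1 + (\<Sum>x\<in>ground M - X. monom (- 1) 0)"
    using finite_ground[OF M] M mu0 mu1 simple_matroidD(2)[OF S]
    by (subst sum.insert) (auto simp: sum.reindex r intro!: sum.cong)
  also have "\<dots> = [:- int (card (ground M - X)), 1:]"
    by (simp only: monom_sum[symmetric]) (simp add: monom_Suc monom_0 one_pCons)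
  finally show ?thesis using char_poly_modular_factor[OF M X(1)] eq by simp
qed

subsection \<open>Rank-preserving surjections\<close>

text \<open>This covers both isomorphisms and the passage to the simplification.\<close>

definition rank_surj :: "('a \<Rightarrow> 'b) \<Rightarrow> 'a matroid \<Rightarrow> 'b matroid \<Rightarrow> bool" where
  "rank_surj f M N \<longleftrightarrow> f ` ground M = ground N \<and> (\<forall>A\<subseteq>ground M. rk N (f ` A) = rk M A)"

lemma rank_surj_ground: "rank_surj f M N \<Longrightarrow> ground N = f ` ground M"
  by (simp add: rank_surj_def)

lemma rank_surj_rk: "rank_surj f M N \<Longrightarrow> A \<subseteq> ground M \<Longrightarrow> rk N (f ` A) = rk M A"
  by (simp add: rank_surj_def)

lemma rank_surj_image_vimage:
  "rank_surj f M N \<Longrightarrow> B \<subseteq> ground N \<Longrightarrow> f ` (f -` B \<inter> ground M) = B"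
  by (drule rank_surj_ground) fastforce

lemma rank_surj_rk_vimage:
  "rank_surj f M N \<Longrightarrow> B \<subseteq> ground N \<Longrightarrow> rk M (f -` B \<inter> ground M) = rk N B"
  using rank_surj_rk[of f M N "f -` B \<inter> ground M"] by (simp add: rank_surj_image_vimage)

lemma rank_surj_restrict:
  "rank_surj f M N \<Longrightarrow> A \<subseteq> ground M \<Longrightarrow> rank_surj f (restrict M A) (restrict N (f ` A))"
  by (auto simp: rank_surj_def)

lemma rank_surj_matroid:
  assumes M: "matroid M" and f: "rank_surj f M N"
  shows "matroid N"
  unfolding matroid_def
proof (intro conjI allI impI)
  let ?v = "\<lambda>B. f -` B \<inter> ground M"
  show "finite (ground N)" using finite_ground[OF M] f by (simp add: rank_surj_ground)
  fix B assume B: "B \<subseteq> ground N"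
  \<comment> \<open>One preimage is chosen per element of \<open>B\<close>: the full preimage may
    have more elements than \<open>B\<close>.\<close>
  then obtain A where A: "A \<subseteq> ground M" "inj_on f A" "B = f ` A"
    using f by (metis rank_surj_ground subset_image_inj)
  then show "rk N B \<le> card B" using rk_le_card[OF M] f by (simp add: rank_surj_rk card_image)
next
  fix A B assume AB: "A \<subseteq> B" "B \<subseteq> ground N"
  have "rk M (f -` A \<inter> ground M) \<le> rk M (f -` B \<inter> ground M)" using AB by (intro rk_mono[OF M]) auto
  then show "rk N A \<le> rk N B" using AB f by (simp add: rank_surj_rk_vimage)
next
  fix A B assume AB: "A \<subseteq> ground N" "B \<subseteq> ground N"
  have "rk M (f -` (A \<union> B) \<inter> ground M) + rk M (f -` (A \<inter> B) \<inter> ground M) \<le>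
    rk M (f -` A \<inter> ground M) + rk M (f -` B \<inter> ground M)"
    using rk_submod[OF M, of "f -` A \<inter> ground M" "f -` B \<inter> ground M"]
    by (simp add: vimage_Un Int_Un_distrib Int_ac)
  moreover have "A \<union> B \<subseteq> ground N" "A \<inter> B \<subseteq> ground N" using AB by auto
  ultimately show "rk N (A \<union> B) + rk N (A \<inter> B) \<le> rk N A + rk N B"
    using AB rank_surj_rk_vimage[OF f, of "A \<union> B"] rank_surj_rk_vimage[OF f, of "A \<inter> B"]
      rank_surj_rk_vimage[OF f, of A] rank_surj_rk_vimage[OF f, of B] by simp
qed

text \<open>Flats are unions of fibres: adding a point with the same image as a member leaves the
  image, hence the rank, unchanged. On flats \<open>f\<close> therefore behaves like a
  bijection.\<close>

lemma rank_surj_flat_mem: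
  assumes "rank_surj f M N" "flat M A" "x \<in> ground M"
  shows "f x \<in> f ` A \<longleftrightarrow> x \<in> A"
proof
  assume "f x \<in> f ` A"
  then have "f ` insert x A = f ` A" by auto
  then have "rk M (insert x A) = rk M A"
    using rank_surj_rk[OF assms(1), of "insert x A"] rank_surj_rk[OF assms(1), of A]
      flat_subset[OF assms(2)] assms(3) by simp
  then show "x \<in> A" using flatD[OF assms(2,3)] by simp
qed auto

lemma rank_surj_flat_subset:
  assumes "rank_surj f M N" "flat M A" "B \<subseteq> ground M"
  shows "f ` B \<subseteq> f ` A \<longleftrightarrow> B \<subseteq> A"
proof -
  have "f x \<in> f ` A \<longleftrightarrow> x \<in> A" if "x \<in> B" for x
    using rank_surj_flat_mem[OF assms(1,2)] assms(3) that by blast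
  then show ?thesis by blast
qed

lemma rank_surj_flat_eq:
  assumes "rank_surj f M N" "flat M A" "flat M B"
  shows "f ` A = f ` B \<longleftrightarrow> A = B"
  using rank_surj_flat_subset[OF assms(1,2) flat_subset[OF assms(3)]]
    rank_surj_flat_subset[OF assms(1,3) flat_subset[OF assms(2)]] by blast

lemma rank_surj_image_Int:
  assumes "rank_surj f M N" "flat M A" "B \<subseteq> ground M"
  shows "f ` (A \<inter> B) = f ` A \<inter> f ` B"
proof
  show "f ` A \<inter> f ` B \<subseteq> f ` (A \<inter> B)"
  proof
    fix y assume y: "y \<in> f ` A \<inter> f ` B"
    then obtain x where x: "x \<in> B" "y = f x" by auto
    then have "x \<in> A" using rank_surj_flat_mem[OF assms(1,2), of x] assms(3) y by simp blast
    then show "y \<in> f ` (A \<inter> B)" using x by blast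
  qed
qed auto

lemma rank_surj_flat_image:
  assumes f: "rank_surj f M N" and A: "flat M A"
  shows "flat N (f ` A)"
proof (rule flatI)
  show "f ` A \<subseteq> ground N" using f flat_subset[OF A] by (auto simp: rank_surj_ground)
  fix y assume y: "y \<in> ground N" "rk N (insert y (f ` A)) = rk N (f ` A)"
  then obtain x where x: "x \<in> ground M" "y = f x" using f by (auto simp: rank_surj_ground)
  then have "rk N (f ` insert x A) = rk N (f ` A)" using y by simp
  then have "rk M (insert x A) = rk M A"
    using rank_surj_rk[OF f, of "insert x A"] rank_surj_rk[OF f, of A] flat_subset[OF A] x by simp
  then show "y \<in> f ` A" using flatD[OF A] x by auto
qed

lemma rank_surj_flat_vimage:
  assumes f: "rank_surj f M N" and B: "flat N B"
  shows "flat M (f -` B \<inter> ground M)"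
proof (rule flatI)
  let ?A = "f -` B \<inter> ground M"
  fix x assume x: "x \<in> ground M" "rk M (insert x ?A) = rk M ?A"
  then have "rk N (f ` insert x ?A) = rk N (f ` ?A)"
    using f by (simp only: rank_surj_rk insert_subset Int_lower2 simp_thms)
  then have "rk N (insert (f x) B) = rk N B"
    using rank_surj_image_vimage[OF f flat_subset[OF B]] by simp
  then show "x \<in> ?A" using flatD[OF B] x f by (simp add: rank_surj_ground)
qed simp

lemma rank_surj_flat_obtain:
  assumes "rank_surj f M N" "flat N B"
  obtains A where "flat M A" "B = f ` A"
  using that[OF rank_surj_flat_vimage[OF assms]] rank_surj_image_vimage[OF assms(1) flat_subset[OF assms(2)]]
  by simp

text \<open>Together with injectivity on flats, this makes taking images an isomorphism of lattices
  of flats. The form below \<open>X\<close> is the one that Moebius sums call for.\<close>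

lemma rank_surj_flats:
  assumes f: "rank_surj f M N" and X: "flat M X"
  shows "{F. flat N F \<and> F \<subseteq> f ` X} = (`) f ` {F. flat M F \<and> F \<subseteq> X}"
proof (intro equalityI subsetI)
  fix F assume F: "F \<in> {F. flat N F \<and> F \<subseteq> f ` X}"
  then obtain A where "flat M A" "F = f ` A" using rank_surj_flat_obtain[OF f] by blast
  then show "F \<in> (`) f ` {F. flat M F \<and> F \<subseteq> X}"
    using F rank_surj_flat_subset[OF f X flat_subset[of M A]] by auto
qed (use rank_surj_flat_image[OF f] in auto)

lemma rank_surj_inj_flats: "rank_surj f M N \<Longrightarrow> inj_on ((`) f) {F. flat M F \<and> P F}"
  by (rule inj_onI) (simp add: rank_surj_flat_eq)

lemma rank_surj_cl_empty:
  assumes M: "matroid M" and f: "rank_surj f M N"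
  shows "cl N {} = f ` cl M {}"
proof (rule flat_eqI)
  note N = rank_surj_matroid[OF M f]
  have F: "flat M (cl M {})" "flat N (cl N {})" using flat_cl M N by auto
  show "matroid N" "flat N (cl N {})" by fact+
  show "cl N {} \<subseteq> f ` cl M {}" by (rule cl_empty_subset[OF N rank_surj_flat_image[OF f F(1)]])
  show "f ` cl M {} \<subseteq> ground N" using rank_surj_flat_image[OF f F(1)] flat_subset by blast
  show "rk N (f ` cl M {}) \<le> rk N (cl N {})"
    using rk_cl[OF M, of "{}"] M rank_surj_rk[OF f cl_subset_ground] by simp
qed

lemma rank_surj_mobius:
  assumes M: "matroid M" and f: "rank_surj f M N" and X: "flat M X"
  shows "mobius N (f ` X) = mobius M X"
proof (rule mobius_unique[OF M _ X])
  fix X assume X: "flat M X"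
  have "(\<Sum>Y | flat M Y \<and> Y \<subseteq> X. mobius N (f ` Y)) = (\<Sum>Z | flat N Z \<and> Z \<subseteq> f ` X. mobius N Z)"
    unfolding rank_surj_flats[OF f X] by (simp add: sum.reindex[OF rank_surj_inj_flats[OF f]])
  also have "\<dots> = (if f ` X = cl N {} then 1 else 0)"
    by (rule sum_mobius[OF rank_surj_matroid[OF M f] rank_surj_flat_image[OF f X]])
  finally show "(\<Sum>Y | flat M Y \<and> Y \<subseteq> X. mobius N (f ` Y)) = (if X = cl M {} then 1 else 0)"
    using rank_surj_flat_eq[OF f X flat_cl[OF M]] rank_surj_cl_empty[OF M f] by simp
qed

lemma rank_surj_char_poly:
  assumes M: "matroid M" and f: "rank_surj f M N"
  shows "char_poly N = char_poly M"
proof -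
  have "{F. flat N F} = (`) f ` {F. flat M F}"
    using rank_surj_flat_image[OF f] rank_surj_flat_obtain[OF f] by blast
  moreover have "rk N (f ` F) = rk M F" if "flat M F" for F
    using that f by (simp add: rank_surj_rk flat_subset)
  ultimately show ?thesis
    using rank_surj_inj_flats[OF f, of "\<lambda>_. True"] f
    by (simp add: char_poly_def sum.reindex rank_surj_mobius[OF M f] rank_surj_ground rank_surj_rk)
qed

text \<open>Only the image of \<open>A\<close> is assumed to be a flat. This serves the projection
  of a flat avoiding the contracted element, which may fail to be closed in the contraction.\<close>

lemma rank_surj_modular:
  assumes M: "matroid M" and f: "rank_surj f M N" and A: "A \<subseteq> ground M" "flat N (f ` A)"
    and le: "\<And>F. flat M F \<Longrightarrow> rk M A + rk M F \<le> rk M (A \<inter> F) + rk M (A \<union> F)"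
  shows "modular_flat N (f ` A)"
  unfolding modular_flat_iff[OF rank_surj_matroid[OF M f]]
proof (intro conjI allI impI A)
  fix G assume "flat N G"
  then obtain F where F: "flat M F" "G = f ` F" using rank_surj_flat_obtain[OF f] by blast
  have "rk N (f ` A \<inter> G) = rk M (A \<inter> F)"
    using rank_surj_image_Int[OF f F(1) A(1)] rank_surj_rk[OF f, of "A \<inter> F"] A F(2) by (simp add: Int_ac le_infI1)
  moreover have "rk N (f ` A \<union> G) = rk M (A \<union> F)"
    using rank_surj_rk[OF f, of "A \<union> F"] A flat_subset[OF F(1)] F(2) by (simp add: image_Un)
  ultimately show "rk N (f ` A) + rk N G \<le> rk N (f ` A \<inter> G) + rk N (f ` A \<union> G)"
    using le[OF F(1)] A flat_subset[OF F(1)] F(2) f by (simp add: rank_surj_rk)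
qed

lemma rank_surj_modular_flat:
  assumes M: "matroid M" and f: "rank_surj f M N" and A: "modular_flat M A"
  shows "modular_flat N (f ` A)"
  using modular_flatD[OF M A] rank_surj_flat_image[OF f] flat_subset[of M A]
  by (intro rank_surj_modular[OF M f]) auto

lemma rank_surj_coatom:
  assumes "rank_surj f M N" "coatom M A"
  shows "coatom N (f ` A)"
  using assms rank_surj_flat_image[OF assms(1)]
  by (auto simp: coatom_def rank_surj_rk rank_surj_ground flat_subset)

text \<open>A cover of \<open>N\<close> by two proper flats pulls back to such a cover of
  \<open>M\<close>, again because flats are unions of fibres.\<close>

lemma rank_surj_round:
  assumes f: "rank_surj f M N" and M: "round_matroid M"
  shows "round_matroid N"
  unfolding round_matroid_def
proof
  assume "\<exists>F G. flat N F \<and> flat N G \<and> F \<noteq> ground N \<and> G \<noteq> ground N \<and> F \<union> G = ground N"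
  then obtain F G where FG: "flat N F" "flat N G" "F \<noteq> ground N" "G \<noteq> ground N" "F \<union> G = ground N"
    by blast
  then obtain A B where AB: "flat M A" "F = f ` A" "flat M B" "G = f ` B"
    using rank_surj_flat_obtain[OF f] by metis
  have "A \<noteq> ground M" "B \<noteq> ground M" using AB FG rank_surj_ground[OF f] by auto
  moreover have "ground M \<subseteq> A \<union> B"
  proof
    fix x assume x: "x \<in> ground M"
    then have "f x \<in> f ` A \<or> f x \<in> f ` B" using FG(5) rank_surj_ground[OF f] AB by auto
    then show "x \<in> A \<union> B" using rank_surj_flat_mem[OF f _ x] AB by auto
  qed
  moreover have "A \<union> B \<subseteq> ground M" using AB flat_subset by blast
  ultimately show False using M AB unfolding round_matroid_def by blast
qed

lemma rank_surj_round_flat: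
  assumes "rank_surj f M N" "round_flat M A"
  shows "round_flat N (f ` A)"
  using assms rank_surj_flat_image rank_surj_round[OF rank_surj_restrict[OF assms(1), of A]]
  by (auto simp: round_flat_def dest: flat_subset)

lemma rank_surj_simple:
  assumes S: "simple_matroid M" and f: "rank_surj f M N"
  shows "simple_matroid N"
proof -
  note M = simple_matroidD(1)[OF S]
  have "rk N {f x} = 1" if "x \<in> ground M" for x
    using rank_surj_rk[OF f, of "{x}"] simple_matroidD(2)[OF S] that by simp
  moreover have "rk N {f x, f y} = 2" if "x \<in> ground M" "y \<in> ground M" "f x \<noteq> f y" for x y
    using rank_surj_rk[OF f, of "{x,y}"] simple_matroidD(3)[OF S] that by force
  ultimately show ?thesis
    using rank_surj_matroid[OF M f] f by (auto simp: simple_matroid_def rank_surj_ground)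
qed

text \<open>On a simple matroid such a map is an isomorphism, and each closure rule is invariant
  under it. Since \<open>M\<close> and \<open>N\<close> may have different element types, membership
  can pass from restrictions of \<open>M\<close> to simplified contractions, whose elements are
  sets.\<close>

lemma rank_surj_ME: "ME M \<Longrightarrow> rank_surj f M N \<Longrightarrow> ME N"
proof (induction M arbitrary: N rule: ME.induct)
  case (empty M)
  then show ?case using rank_surj_simple by (intro ME.empty) (auto simp: rank_surj_ground)
next
  case (coatom M X)
  note M = simple_matroidD(1)[OF coatom.hyps(1)]
  have "X \<subseteq> ground M" using coatom.hyps(2) M modular_flatD flat_subset by blast
  then show ?case
    using coatom.IH[OF rank_surj_restrict[OF coatom.prems]] coatom.hyps coatom.prems M
    by (intro ME.coatom[of N "f ` X"])
      (auto intro: rank_surj_simple rank_surj_modular_flat rank_surj_coatom)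
next
  case (join M E1 E2)
  note f = join.prems
  have J: "simple_matroid M" "ground M = E1 \<union> E2" "modular_flat M E1" "E1 \<noteq> ground M"
      "modular_flat M E2" "E2 \<noteq> ground M"
    using join.hyps(1) by (auto simp: modular_join_def)
  note M = simple_matroidD(1)[OF J(1)]
  have F: "flat M E1" "flat M E2" using J M modular_flatD by blast+
  have ne: "f ` E1 \<noteq> ground N" "f ` E2 \<noteq> ground N"
    using J rank_surj_flat_eq[OF f _ flat_ground] F rank_surj_ground[OF f] by auto
  have "modular_join N (f ` E1) (f ` E2)"
    using J ne rank_surj_simple[OF J(1) f] rank_surj_modular_flat[OF M f] rank_surj_ground[OF f]
    by (auto simp: modular_join_def)
  moreover have "round_flat N (f ` E1 \<inter> f ` E2)"
    using rank_surj_round_flat[OF f join.hyps(2)] rank_surj_image_Int[OF f F(1) flat_subset[OF F(2)]] by simp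
  ultimately show ?case
    using join.IH(1)[OF rank_surj_restrict[OF f flat_subset[OF F(1)]]]
      join.IH(2)[OF rank_surj_restrict[OF f flat_subset[OF F(2)]]]
    by (rule ME.join)
qed

subsection \<open>Simplification and contraction\<close>

lemma cl_singleton_eq:
  assumes M: "matroid M" "\<And>x. x \<in> ground M \<Longrightarrow> rk M {x} = 1" and F: "flat M F" "rk M F = 1" "x \<in> F"
  shows "cl M {x} = F"
proof (rule flat_eqI[OF M(1)])
  have x: "x \<in> ground M" using F flat_subset by auto
  show "flat M (cl M {x})" using flat_cl[OF M(1)] x by simp
  show "cl M {x} \<subseteq> F" using cl_subset_flat[OF M(1) F(1)] F by simp
  show "F \<subseteq> ground M" using F flat_subset by auto
  show "rk M F \<le> rk M (cl M {x})" using rk_cl[OF M(1)] M(2)[OF x] F x by simp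
qed

text \<open>The rank-one flats inside \<open>X\<close> are the closures of the points of
  \<open>X\<close>. The choice-free form of \<open>si\<close> makes this an equality rather than an
  isomorphism.\<close>

lemma si_restrict:
  assumes M: "matroid M" "\<And>x. x \<in> ground M \<Longrightarrow> rk M {x} = 1" and X: "flat M X"
  shows "si (restrict M X) = restrict (si M) ((\<lambda>x. cl M {x}) ` X)"
proof -
  have "{F. flat (restrict M X) F \<and> rk M F = 1} = (\<lambda>x. cl M {x}) ` X"
  proof (intro equalityI subsetI)
    fix F assume "F \<in> {F. flat (restrict M X) F \<and> rk M F = 1}"
    then have F: "flat M F" "F \<subseteq> X" "rk M F = 1" by (auto simp: flat_restrict_iff M X)
    moreover from F(3) have "F \<noteq> {}" using M(1) by auto
    ultimately show "F \<in> (\<lambda>x. cl M {x}) ` X" using cl_singleton_eq[OF M] by blast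
  next
    fix F assume "F \<in> (\<lambda>x. cl M {x}) ` X"
    then obtain x where x: "x \<in> X" "F = cl M {x}" by auto
    then have "x \<in> ground M" using X flat_subset by auto
    then show "F \<in> {F. flat (restrict M X) F \<and> rk M F = 1}"
      using M x X flat_cl[OF M(1)] rk_cl[OF M(1)] cl_subset_flat[OF M(1) X]
      by (simp add: flat_restrict_iff)
  qed
  then show ?thesis by (simp add: si_def restrict_def)
qed

lemma restrict_ground [simp]: "restrict M (ground M) = M"
  by (cases M) (simp add: restrict_def)

text \<open>The union of the parallel classes of the points of \<open>A\<close> lies between
  \<open>A\<close> and its closure, so it has the rank of \<open>A\<close>.\<close>

lemma rank_surj_si:
  assumes M: "matroid M" "\<And>x. x \<in> ground M \<Longrightarrow> rk M {x} = 1"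
  shows "rank_surj (\<lambda>x. cl M {x}) M (si M)"
  unfolding rank_surj_def
proof (intro conjI allI impI)
  \<comment> \<open>Applied to the whole ground set as the flat, \<open>si_restrict\<close> says
    that every element of \<open>si M\<close> is the closure of a point.\<close>
  have "ground (si M) = ground (restrict (si M) ((\<lambda>x. cl M {x}) ` ground M))"
    using si_restrict[OF M flat_ground] by simp
  then show "(\<lambda>x. cl M {x}) ` ground M = ground (si M)" by simp
  fix A assume A: "A \<subseteq> ground M"
  have "rk M (\<Union>x\<in>A. cl M {x}) = rk M A"
  proof (rule rk_between_cl[OF M(1) A])
    show "A \<subseteq> (\<Union>x\<in>A. cl M {x})" using A subset_cl[of "{x}" M for x] by blast
    show "(\<Union>x\<in>A. cl M {x}) \<subseteq> cl M A" using cl_mono[OF M(1) _ A] by blast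
  qed
  then show "rk (si M) ((\<lambda>x. cl M {x}) ` A) = rk M A" by (simp add: si_def)
qed

lemma cl_singleton_eqI:
  assumes M: "matroid M" "\<And>x. x \<in> ground M \<Longrightarrow> rk M {x} = 1"
    and xy: "x \<in> ground M" "y \<in> ground M" "rk M {x, y} = 1"
  shows "cl M {x} = cl M {y}"
proof (rule cl_singleton_eq[OF M])
  show "flat M (cl M {y})" "rk M (cl M {y}) = 1" using flat_cl[OF M(1)] rk_cl[OF M(1)] M(2) xy by auto
  show "x \<in> cl M {y}" using xy M(2) by (simp add: cl_def)
qed auto

lemma simple_si:
  assumes M: "matroid M" "\<And>x. x \<in> ground M \<Longrightarrow> rk M {x} = 1"
  shows "simple_matroid (si M)"
proof -
  note f = rank_surj_si[OF M]
  let ?f = "\<lambda>x. cl M {x}"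
  have "rk (si M) {?f x} = 1" if "x \<in> ground M" for x
    using rank_surj_rk[OF f, of "{x}"] M(2) that by simp
  moreover have "rk (si M) {?f x, ?f y} = 2" if "x \<in> ground M" "y \<in> ground M" "?f x \<noteq> ?f y" for x y
  proof -
    have "rk M {x, y} \<noteq> 1" using cl_singleton_eqI[OF M] that by blast
    moreover have "rk M {x, y} \<le> 2" "1 \<le> rk M {x, y}"
      using rk_le_card[OF M(1), of "{x,y}"] card_length[of "[x,y]"] rk_mono[OF M(1), of "{x}" "{x,y}"] M(2) that by auto
    ultimately show ?thesis using rank_surj_rk[OF f, of "{x,y}"] that by simp
  qed
  ultimately show ?thesis
    using rank_surj_matroid[OF M(1) f] f by (auto simp: simple_matroid_def rank_surj_ground)
qed

lemma ground_contract [simp]: "ground (contract M e) = ground M - {e}"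
  by (simp add: contract_def)

lemma restrict_contract: "restrict (contract M e) (X - {e}) = contract (restrict M X) e"
  by (simp add: contract_def restrict_def)

text \<open>The additive form avoids the truncated subtraction in \<open>contract\<close>;
  simplicity gives \<open>{e}\<close> rank 1.\<close>

lemma rk_contract:
  assumes "simple_matroid M" "e \<in> ground M" "A \<subseteq> ground M"
  shows "rk M (insert e A) = rk (contract M e) A + 1"
  using rk_mono[of M "{e}" "insert e A"] simple_matroidD[OF assms(1)] assms by (simp add: contract_def)

lemma matroid_contract:
  assumes S: "simple_matroid M" and e: "e \<in> ground M"
  shows "matroid (contract M e)"
  unfolding matroid_def
proof (intro conjI allI impI)
  note M = simple_matroidD(1)[OF S]
  note rk = rk_contract[OF S e]
  show "finite (ground (contract M e))" using finite_ground[OF M] by simp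
  fix A assume A: "A \<subseteq> ground (contract M e)"
  then have "rk (contract M e) A \<le> rk M A" using rk[of A] rk_insert_le[OF M _ e, of A] by fastforce
  then show "rk (contract M e) A \<le> card A" using rk_le_card[OF M, of A] A by fastforce
next
  note M = simple_matroidD(1)[OF S]
  note rk = rk_contract[OF S e]
  fix A B assume AB: "A \<subseteq> B" "B \<subseteq> ground (contract M e)"
  then show "rk (contract M e) A \<le> rk (contract M e) B"
    using rk_mono[OF M, of "insert e A" "insert e B"] e by (auto simp: rk subset_iff)
next
  note M = simple_matroidD(1)[OF S]
  note rk = rk_contract[OF S e]
  fix A B assume AB: "A \<subseteq> ground (contract M e)" "B \<subseteq> ground (contract M e)"
  then have sub: "A \<subseteq> ground M" "B \<subseteq> ground M" "A \<union> B \<subseteq> ground M" "A \<inter> B \<subseteq> ground M" by auto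
  have "rk M (insert e A \<union> insert e B) + rk M (insert e (A \<inter> B)) \<le> rk M (insert e A) + rk M (insert e B)"
    using sub e by (intro rk_submod_subset[OF M]) auto
  also have "insert e A \<union> insert e B = insert e (A \<union> B)" by auto
  finally show "rk (contract M e) (A \<union> B) + rk (contract M e) (A \<inter> B) \<le> rk (contract M e) A + rk (contract M e) B"
    by (simp add: rk sub)
qed

lemma loopless_contract:
  assumes S: "simple_matroid M" and e: "e \<in> ground M" and x: "x \<in> ground (contract M e)"
  shows "rk (contract M e) {x} = 1"
  using rk_contract[OF S e, of "{x}"] simple_matroidD(3)[OF S e, of x] x by auto

lemma flat_contract_iff:
  assumes S: "simple_matroid M" and e: "e \<in> ground M"
  shows "flat (contract M e) F \<longleftrightarrow> e \<notin> F \<and> flat M (insert e F)"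
proof (cases "F \<subseteq> ground M - {e}")
  case True
  have *: "rk (contract M e) (insert x F) = rk (contract M e) F \<longleftrightarrow>
    rk M (insert x (insert e F)) = rk M (insert e F)" if "x \<in> ground M" for x
  proof -
    have "insert x F \<subseteq> ground M" "F \<subseteq> ground M" using that True by auto
    then show ?thesis by (simp add: rk_contract[OF S e] insert_commute[of x e])
  qed
  show ?thesis
  proof
    assume F: "flat (contract M e) F"
    show "e \<notin> F \<and> flat M (insert e F)"
    proof (intro conjI flatI)
      fix x assume "x \<in> ground M" "rk M (insert x (insert e F)) = rk M (insert e F)"
      then show "x \<in> insert e F" using flatD[OF F, of x] * by auto
    qed (use True e in auto)
  next
    assume F: "e \<notin> F \<and> flat M (insert e F)"
    show "flat (contract M e) F"
    proof (rule flatI)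
      fix x assume "x \<in> ground (contract M e)" "rk (contract M e) (insert x F) = rk (contract M e) F"
      then show "x \<in> F" using flatD[of M "insert e F" x] F * by auto
    qed (use True in auto)
  qed
next
  case False
  then show ?thesis using flat_subset[of "contract M e" F] flat_subset[of M "insert e F"] by auto
qed

text \<open>Flats of the contraction are the flats of \<open>M\<close> through \<open>e\<close> with
  \<open>e\<close> removed, and in the modular equation every rank drops by 1.\<close>

lemma modular_contract:
  assumes S: "simple_matroid M" and X: "modular_flat M X" and e: "e \<in> X"
  shows "modular_flat (contract M e) (X - {e})"
proof -
  note M = simple_matroidD(1)[OF S]
  have FX: "flat M X" "X \<subseteq> ground M" using modular_flatD[OF M X] flat_subset by auto
  then have eM: "e \<in> ground M" using e by auto
  note rk = rk_contract[OF S eM]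
  have "rk (contract M e) (X - {e}) + rk (contract M e) F \<le>
      rk (contract M e) ((X - {e}) \<inter> F) + rk (contract M e) ((X - {e}) \<union> F)"
    if "flat (contract M e) F" for F
  proof -
    have F: "e \<notin> F" "flat M (insert e F)" using that by (auto simp: flat_contract_iff[OF S eM])
    have "F \<subseteq> ground M" using flat_subset[OF F(2)] by auto
    then have sub: "X - {e} \<subseteq> ground M" "F \<subseteq> ground M" "(X - {e}) \<inter> F \<subseteq> ground M" "(X - {e}) \<union> F \<subseteq> ground M"
      using FX by auto
    have "insert e (X - {e}) = X" "insert e ((X - {e}) \<inter> F) = X \<inter> insert e F"
      "insert e ((X - {e}) \<union> F) = X \<union> insert e F" using e F by auto
    then show ?thesis using sub[THEN rk] modular_flatD(2)[OF M X F(2)] by simp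
  qed
  then show ?thesis
    using FX e by (auto simp: modular_flat_iff[OF matroid_contract[OF S eM]] flat_contract_iff[OF S eM] insert_absorb)
qed

subsection \<open>The simplified contraction of a simple matroid\<close>

abbreviation (input) si_contract :: "'a matroid \<Rightarrow> 'a \<Rightarrow> 'a set matroid" where
  "si_contract M e \<equiv> si (contract M e)"

text \<open>Projection from \<open>e\<close>: in a simple matroid a point \<open>x\<close> other
  than \<open>e\<close> goes to its parallel class in the contraction, which is the line through
  \<open>e\<close> and \<open>x\<close> without \<open>e\<close>.\<close>

abbreviation proj :: "'a matroid \<Rightarrow> 'a \<Rightarrow> 'a \<Rightarrow> 'a set" where
  "proj M e x \<equiv> cl (contract M e) {x}"

lemma simple_si_contract:
  "simple_matroid M \<Longrightarrow> e \<in> ground M \<Longrightarrow> simple_matroid (si_contract M e)"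
  by (rule simple_si) (auto simp: matroid_contract loopless_contract)

lemma rank_surj_proj:
  "simple_matroid M \<Longrightarrow> e \<in> ground M \<Longrightarrow> rank_surj (proj M e) (contract M e) (si_contract M e)"
  by (rule rank_surj_si) (auto simp: matroid_contract loopless_contract)

lemma char_poly_si_contract:
  assumes "simple_matroid M" "e \<in> ground M"
  shows "char_poly (si_contract M e) = char_poly (contract M e)"
  by (rule rank_surj_char_poly[OF matroid_contract rank_surj_proj]) (use assms in auto)

lemma si_contract_restrict:
  assumes S: "simple_matroid M" and X: "flat M X" and e: "e \<in> X"
  shows "si_contract (restrict M X) e = restrict (si_contract M e) (proj M e ` (X - {e}))"
proof -
  have eM: "e \<in> ground M" using X e flat_subset by auto
  have "flat (contract M e) (X - {e})"
    using X e by (simp add: flat_contract_iff[OF S eM] insert_absorb)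
  from si_restrict[OF matroid_contract[OF S eM] loopless_contract[OF S eM] this]
  show ?thesis by (simp add: restrict_contract)
qed

text \<open>Adding \<open>e\<close> raises the rank of every subset of \<open>Y\<close> by exactly
  1, so contracting \<open>e\<close> preserves the ranks inside \<open>Y\<close>. The projection of
  \<open>Y\<close> is thus a copy of \<open>restrict M Y\<close>.\<close>

lemma rank_surj_proj_restrict:
  assumes S: "simple_matroid M" and Y: "flat M Y" and e: "e \<in> ground M" "e \<notin> Y"
  shows "rank_surj (proj M e) (restrict M Y) (restrict (si_contract M e) (proj M e ` Y))"
  unfolding rank_surj_def
proof (intro conjI allI impI)
  fix A assume "A \<subseteq> ground (restrict M Y)"
  then have A: "A \<subseteq> Y" by simp
  then have sub: "A \<subseteq> ground M" "A \<subseteq> ground (contract M e)" using flat_subset[OF Y] e by auto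
  have "rk M (insert e A) = rk M A + 1"
    by (rule rk_insert_subset_flat[OF simple_matroidD(1)[OF S] Y e A])
  then show "rk (restrict (si_contract M e) (proj M e ` Y)) (proj M e ` A) = rk (restrict M Y) A"
    using rk_contract[OF S e(1) sub(1)] rank_surj_rk[OF rank_surj_proj[OF S e(1)] sub(2)] by simp
qed simp

lemma proj_modular:
  assumes S: "simple_matroid M" and X: "modular_flat M X" and e: "e \<in> X"
  shows "modular_flat (si_contract M e) (proj M e ` (X - {e}))"
proof -
  have "e \<in> ground M" using modular_flatD[OF simple_matroidD(1)[OF S] X] flat_subset e by auto
  then show ?thesis
    using rank_surj_modular_flat[OF matroid_contract rank_surj_proj modular_contract[OF S X e]] S by auto
qed

lemma proj_modular_avoiding:
  assumes S: "simple_matroid M" and Y: "modular_flat M Y" and e: "e \<in> ground M" "e \<notin> Y"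
  shows "modular_flat (si_contract M e) (proj M e ` Y)"
proof -
  note M = simple_matroidD(1)[OF S]
  note rk = rk_contract[OF S e(1)]
  note f = rank_surj_proj[OF S e(1)]
  note N = matroid_contract[OF S e(1)] loopless_contract[OF S e(1)]
  have FY: "flat M Y" "Y \<subseteq> ground M" using modular_flatD[OF M Y] flat_subset by auto
  have sub: "Y \<subseteq> ground (contract M e)" using FY e by auto
  have rkY: "rk (contract M e) A = rk M A" if "A \<subseteq> Y" for A
    using rk[of A] rk_insert_subset_flat[OF M FY(1) e that] that FY by auto
  show ?thesis
  proof (rule rank_surj_modular[OF N(1) f sub])
    show "flat (si_contract M e) (proj M e ` Y)"
    proof (rule flatI)
      show "proj M e ` Y \<subseteq> ground (si_contract M e)" using sub rank_surj_ground[OF f] by auto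
      fix z assume z: "z \<in> ground (si_contract M e)"
        "rk (si_contract M e) (insert z (proj M e ` Y)) = rk (si_contract M e) (proj M e ` Y)"
      then obtain x where x: "x \<in> ground M" "x \<noteq> e" "z = proj M e x"
        using rank_surj_ground[OF f] by auto
      have "rk (contract M e) (insert x Y) = rk M Y"
        using z x rank_surj_rk[OF f, of "insert x Y"] rank_surj_rk[OF f, of Y] sub rkY[of Y] by simp
      then have "rk M (insert x (insert e Y)) = rk M Y + 1"
        using rk[of "insert x Y"] x FY by (simp add: insert_commute)
      \<comment> \<open>A point \<open>x\<close> spanned by \<open>Y\<close> and \<open>e\<close> is
        parallel in the contraction to a point of \<open>Y\<close>, namely where its line through
        \<open>e\<close> meets \<open>Y\<close>. Hence the image of \<open>Y\<close> is
        closed.\<close>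
      then obtain g where g: "g \<in> Y" "rk M {e, g, x} = 2"
        using modular_flat_line[OF S Y e x(1,2)] by auto
      have "rk (contract M e) {g, x} = 1" using rk[of "{g, x}"] g x FY by auto
      then have "proj M e g = proj M e x" using cl_singleton_eqI[OF N] g x sub by auto
      then show "z \<in> proj M e ` Y" using x g by auto
    qed
    fix F assume "flat (contract M e) F"
    then have F: "e \<notin> F" "flat M (insert e F)" by (auto simp: flat_contract_iff[OF S e(1)])
    then have sF: "F \<subseteq> ground M" using flat_subset by auto
    have "Y \<inter> insert e F = Y \<inter> F" "Y \<union> insert e F = insert e (Y \<union> F)" using e by auto
    then show "rk (contract M e) Y + rk (contract M e) F \<le>
      rk (contract M e) (Y \<inter> F) + rk (contract M e) (Y \<union> F)"
      using modular_flatD(2)[OF M Y F(2)] rk[of F] rk[of "Y \<union> F"] rkY[of Y] rkY[of "Y \<inter> F"] sF FY by simp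
  qed
qed

subsection \<open>Divisional atoms outside a round flat\<close>

lemma rk_Un_coatom:
  assumes M: "matroid M" and Y: "coatom M Y" and e: "e \<in> A" "e \<notin> Y" "A \<subseteq> ground M"
  shows "rk M (Y \<union> A) = rk M Y + 1"
proof -
  have FY: "flat M Y" "Y \<subseteq> ground M" using Y by (auto simp: coatom_def flat_def)
  have "rk M (insert e Y) \<le> rk M (Y \<union> A)" using FY e by (intro rk_mono[OF M]) auto
  moreover have "rk M (Y \<union> A) \<le> rk M (ground M)" using FY e by (intro rk_mono[OF M]) auto
  ultimately show ?thesis using rk_insert_flat[OF M FY(1), of e] e Y by (auto simp: coatom_def)
qed

text \<open>Projecting \<open>X\<close> from a point \<open>e \<in> X - Y\<close> onto \<open>Y\<close> identifies \<open>X \<inter> Y\<close> with the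
  simplified contraction of \<open>X\<close> by \<open>e\<close>, and contractions of round matroids are round.\<close>

lemma round_flat_Int_modular_coatom:
  assumes S: "simple_matroid M" and Y: "modular_flat M Y" "coatom M Y"
    and X: "round_flat M X" "\<not> X \<subseteq> Y"
  shows "round_flat M (X \<inter> Y)"
proof -
  note M = simple_matroidD(1)[OF S]
  have FY: "flat M Y" "Y \<subseteq> ground M" using modular_flatD[OF M Y(1)] flat_subset by auto
  have FX: "flat M X" "X \<subseteq> ground M" using X flat_subset by (auto simp: round_flat_def)
  note FI = flat_Int[OF M FX(1) FY(1)]
  obtain e where e: "e \<in> X" "e \<notin> Y" using X by auto
  then have eM: "e \<in> ground M" using FX by auto
  have rk: "rk M (X \<inter> Y) + 1 = rk M X"
    using modular_flatD(2)[OF M Y(1) FX(1)] rk_Un_coatom[OF M Y(2) e FX(2)] by (simp add: Int_commute)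
  \<comment> \<open>A proper flat of \<open>X \<inter> Y\<close> spans together with
    \<open>e\<close> a proper flat of \<open>X\<close>, since \<open>X \<inter> Y\<close> has corank
    1 in \<open>X\<close>.\<close>
  have lift: "flat (restrict M X) (cl M (insert e F))" "cl M (insert e F) \<noteq> X"
    if F: "flat M F" "F \<subseteq> X \<inter> Y" "F \<noteq> X \<inter> Y" for F
  proof -
    have sub: "insert e F \<subseteq> ground M" using F eM FX by auto
    have "rk M F < rk M (X \<inter> Y)" using F FX by (intro rk_flat_strict[OF M]) auto
    then have "rk M (cl M (insert e F)) < rk M X"
      using rk_cl[OF M sub] rk_insert_le[OF M _ eM, of F] sub rk by simp
    then show "cl M (insert e F) \<noteq> X" by auto
    show "flat (restrict M X) (cl M (insert e F))"
      using flat_cl[OF M sub] cl_subset_flat[OF M FX(1), of "insert e F"] F e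
      by (auto simp: flat_restrict_iff[OF M FX(1)])
  qed
  have "round_matroid (restrict M (X \<inter> Y))"
    unfolding round_matroid_def
  proof
    assume "\<exists>F G. flat (restrict M (X \<inter> Y)) F \<and> flat (restrict M (X \<inter> Y)) G \<and>
      F \<noteq> ground (restrict M (X \<inter> Y)) \<and> G \<noteq> ground (restrict M (X \<inter> Y)) \<and>
      F \<union> G = ground (restrict M (X \<inter> Y))"
    then obtain F G where FG: "flat M F" "F \<subseteq> X \<inter> Y" "F \<noteq> X \<inter> Y" "flat M G" "G \<subseteq> X \<inter> Y" "G \<noteq> X \<inter> Y"
      and Un: "F \<union> G = X \<inter> Y"
      by (auto simp: flat_restrict_iff[OF M FI])
    let ?F = "cl M (insert e F)" and ?G = "cl M (insert e G)"
    have sub: "insert e F \<subseteq> ground M" "insert e G \<subseteq> ground M" using FG eM FX by auto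
    have "X \<subseteq> ?F \<union> ?G"
    proof
      fix x assume x: "x \<in> X"
      show "x \<in> ?F \<union> ?G"
      proof (cases "x = e")
        case True
        then show ?thesis using subset_cl[OF sub(1)] by auto
      next
        case False
        have xM: "x \<in> ground M" using x FX by auto
        have "rk M (insert x (insert e Y)) = rk M Y + 1"
          using rk_Un_coatom[OF M Y(2), of e "{x, e}"] e xM eM by simp
        \<comment> \<open>The projection \<open>g\<close> of \<open>x\<close> stays in
          \<open>X\<close>, so it lies in \<open>F\<close> or \<open>G\<close>. Then
          \<open>x\<close>, on the line through \<open>e\<close> and \<open>g\<close>, lies in the
          corresponding lift.\<close>
        then obtain g where g: "g \<in> Y" "rk M {e, g, x} = 2"
          using modular_flat_line[OF S Y(1) eM e(2) xM False] by auto
        have gM: "g \<in> ground M" "g \<noteq> e" using g FY e by auto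
        have "rk M (insert g {e, x}) = rk M {e, x}"
          using g simple_matroidD(3)[OF S eM xM] False by (simp add: insert_commute)
        then have "g \<in> cl M {e, x}" using gM by (simp add: cl_def)
        then have "g \<in> F \<union> G" using cl_subset_flat[OF M FX(1), of "{e, x}"] e x g Un by auto
        moreover have "rk M (insert x {e, g}) = rk M {e, g}"
          using g simple_matroidD(3)[OF S eM gM(1)] gM by (simp add: insert_commute)
        then have "x \<in> cl M {e, g}" using xM by (simp add: cl_def)
        ultimately show ?thesis
          using cl_mono[OF M _ sub(1), of "{e, g}"] cl_mono[OF M _ sub(2), of "{e, g}"] by auto
      qed
    qed
    moreover have "flat (restrict M X) ?F" "flat (restrict M X) ?G" "?F \<noteq> X" "?G \<noteq> X"
      using lift FG by auto
    moreover from this have "?F \<union> ?G \<subseteq> X" using flat_subset[of "restrict M X"] by auto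
    ultimately have "\<not> round_matroid (restrict M X)"
      unfolding round_matroid_def ground_restrict by blast
    then show False using X by (simp add: round_flat_def)
  qed
  then show ?thesis using FI by (simp add: round_flat_def)
qed

text \<open>The projected copy of \<open>Y\<close> is a flat of full rank in the simplified
  contraction, hence all of it. So the contraction has the characteristic polynomial of
  \<open>restrict M Y\<close>, which is a factor of that of \<open>M\<close>.\<close>

lemma divisional_outside_coatom:
  assumes S: "simple_matroid M" and Y: "modular_flat M Y" "coatom M Y" "ME (restrict M Y)"
    and e: "e \<in> ground M" "e \<notin> Y"
  shows "divisional_atom M e \<and> ME (si_contract M e)"
proof -
  note M = simple_matroidD(1)[OF S]
  have FY: "flat M Y" "Y \<subseteq> ground M" using modular_flatD[OF M Y(1)] flat_subset by auto
  let ?S = "si_contract M e"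
  note SS = simple_si_contract[OF S e(1)]
  note f = rank_surj_proj[OF S e(1)]
  note g = rank_surj_proj_restrict[OF S FY(1) e]
  have "flat ?S (proj M e ` Y)"
    using modular_flatD[OF simple_matroidD(1)[OF SS] proj_modular_avoiding[OF S Y(1) e]] by simp
  moreover have "rk ?S (proj M e ` Y) = rk M Y" using rank_surj_rk[OF g, of Y] by simp
  moreover have "rk ?S (ground ?S) = rk (contract M e) (ground M - {e})"
    using rank_surj_rk[OF f, of "ground M - {e}"] rank_surj_ground[OF f] by simp
  moreover have "rk (contract M e) (ground M - {e}) = rk M Y"
    using rk_contract[OF S e(1), of "ground M - {e}"] Y(2) e by (simp add: coatom_def insert_absorb)
  ultimately have "proj M e ` Y = ground ?S"
    using flat_subset by (intro flat_eqI[OF simple_matroidD(1)[OF SS]]) auto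
  with g have h: "rank_surj (proj M e) (restrict M Y) ?S" by simp
  have "char_poly (contract M e) = char_poly (restrict M Y)"
    using rank_surj_char_poly[OF matroid_restrict[OF M FY(2)] h] char_poly_si_contract[OF S e(1)] by simp
  then have "char_poly (contract M e) dvd char_poly M"
    unfolding char_poly_modular_coatom[OF S Y(1,2)] by (metis dvd_triv_left)
  then show ?thesis using rank_surj_ME[OF Y(3) h] e by (simp add: divisional_atom_def)
qed

text \<open>Both \<open>M\<close> and its simplified contraction have a modular coatom, coming from
  \<open>Y\<close>. The linear cofactors agree because projection from \<open>e\<close> is injective
  on the points outside \<open>Y\<close>, leaving divisibility inside \<open>Y\<close>.\<close>

lemma divisional_inside_coatom:
  assumes S: "simple_matroid M" and Y: "modular_flat M Y" "coatom M Y"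
    and X: "flat M X" "ground M = X \<union> Y" and e: "e \<in> Y" "e \<notin> X"
    and div: "divisional_atom (restrict M Y) e" "ME (si_contract (restrict M Y) e)"
  shows "divisional_atom M e \<and> ME (si_contract M e)"
proof -
  note M = simple_matroidD(1)[OF S]
  have FY: "flat M Y" "Y \<subseteq> ground M" using modular_flatD[OF M Y(1)] flat_subset by auto
  have eM: "e \<in> ground M" using e FY by auto
  let ?S = "si_contract M e" and ?D = "proj M e ` (Y - {e})"
  note SS = simple_si_contract[OF S eM]
  note f = rank_surj_proj[OF S eM]
  note D = proj_modular[OF S Y(1) e(1)]
  have FYe: "flat (contract M e) (Y - {e})"
    using FY e by (simp add: flat_contract_iff[OF S eM] insert_absorb)
  have "coatom (contract M e) (Y - {e})"
    using FYe rk_contract[OF S eM, of "Y - {e}", OF subset_trans[OF Diff_subset FY(2)]] rk_contract[OF S eM, of "ground M - {e}"] Y(2) FY e eM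
    by (auto simp: coatom_def insert_absorb)
  then have co: "coatom ?S ?D" by (rule rank_surj_coatom[OF f])
  have res: "restrict ?S ?D = si_contract (restrict M Y) e"
    using si_contract_restrict[OF S FY(1) e(1)] by simp
  have ME: "ME ?S" using ME.coatom[OF SS D co] div(2) res by simp
  \<comment> \<open>Points outside \<open>Y\<close> lie in the flat \<open>X\<close>. A line joining
    two of them stays in \<open>X\<close> and so misses \<open>e\<close>.\<close>
  have "inj_on (proj M e) (ground M - Y)"
  proof (rule inj_onI, rule ccontr)
    fix x y assume xy: "x \<in> ground M - Y" "y \<in> ground M - Y" "proj M e x = proj M e y" "x \<noteq> y"
    then have xM: "x \<in> ground M" "y \<in> ground M" "x \<noteq> e" "y \<noteq> e" "x \<in> X" "y \<in> X" using e X(2) by auto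
    have "rk (contract M e) {x, y} = rk ?S {proj M e x}"
      using rank_surj_rk[OF f, of "{x, y}"] xM xy(3) by simp
    also have "\<dots> = 1" using rank_surj_rk[OF f, of "{x}"] loopless_contract[OF S eM, of x] xM by simp
    finally have "rk M (insert e {x, y}) = rk M {x, y}"
      using rk_contract[OF S eM, of "{x, y}"] simple_matroidD(3)[OF S xM(1,2) xy(4)] xM by simp
    then have "e \<in> cl M {x, y}" using eM by (simp add: cl_def)
    then show False using cl_subset_flat[OF M X(1), of "{x, y}"] xM e by auto
  qed
  moreover have "ground ?S - ?D = proj M e ` (ground M - Y)"
  proof -
    have "proj M e x \<in> ?D \<longleftrightarrow> x \<in> Y" if "x \<in> ground M" "x \<noteq> e" for x
      using rank_surj_flat_mem[OF f FYe, of x] that by simp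
    then show ?thesis using rank_surj_ground[OF f] e(1) by auto
  qed
  ultimately have "card (ground ?S - ?D) = card (ground M - Y)" by (simp add: card_image)
  then have "char_poly (contract M e) =
      char_poly (contract (restrict M Y) e) * [:- int (card (ground M - Y)), 1:]"
    using char_poly_modular_coatom[OF SS D co] char_poly_si_contract[OF S eM] res
      char_poly_si_contract[OF simple_restrict[OF S FY(2)], of e] e by simp
  moreover have "char_poly (contract (restrict M Y) e) dvd char_poly (restrict M Y)"
    using div(1) by (simp add: divisional_atom_def)
  ultimately have "char_poly (contract M e) dvd char_poly M"
    unfolding char_poly_modular_coatom[OF S Y] by (metis mult_dvd_mono dvd_refl)
  then show ?thesis using ME eM by (simp add: divisional_atom_def)
qed

text \<open>Projection from \<open>e\<close> contracts the part \<open>E1\<close> and copies both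
  \<open>E2\<close> and the common flat. In the product formula for modular covers, only the factor
  of \<open>E1\<close> changes.\<close>

lemma divisional_modular_join:
  assumes J: "modular_join M E1 E2" and W: "round_flat M (E1 \<inter> E2)" and ME2: "ME (restrict M E2)"
    and e: "e \<in> E1" "e \<notin> E2"
    and div: "divisional_atom (restrict M E1) e" "ME (si_contract (restrict M E1) e)"
  shows "divisional_atom M e \<and> ME (si_contract M e)"
proof -
  have S: "simple_matroid M" and E: "ground M = E1 \<union> E2" "modular_flat M E1" "modular_flat M E2"
    and ne: "E1 \<noteq> ground M"
    using J by (auto simp: modular_join_def)
  note M = simple_matroidD(1)[OF S]
  have F: "flat M E1" "flat M E2" "flat M (E1 \<inter> E2)" using E modular_flatD[OF M] flat_Int[OF M] by blast+
  have eM: "e \<in> ground M" using e E by auto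
  let ?S = "si_contract M e" and ?D1 = "proj M e ` (E1 - {e})" and ?D2 = "proj M e ` E2"
  note SS = simple_si_contract[OF S eM]
  note MS = simple_matroidD(1)[OF SS]
  note f = rank_surj_proj[OF S eM]
  note D = proj_modular[OF S E(2) e(1)] proj_modular_avoiding[OF S E(3) eM e(2)]
  have FE: "flat (contract M e) (E1 - {e})"
    using F e by (simp add: flat_contract_iff[OF S eM] insert_absorb)
  have sub: "E2 \<subseteq> ground (contract M e)" using E e by auto
  have ground: "ground ?S = ?D1 \<union> ?D2"
  proof -
    have "ground M - {e} = (E1 - {e}) \<union> E2" using E e by auto
    then show ?thesis using rank_surj_ground[OF f] by (simp add: image_Un)
  qed
  have Int: "?D1 \<inter> ?D2 = proj M e ` (E1 \<inter> E2)"
  proof -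
    have "(E1 - {e}) \<inter> E2 = E1 \<inter> E2" using e by auto
    then show ?thesis using rank_surj_image_Int[OF f FE sub] by simp
  qed
  note g2 = rank_surj_proj_restrict[OF S F(2) eM e(2)]
  have gW: "rank_surj (proj M e) (restrict M (E1 \<inter> E2)) (restrict ?S (?D1 \<inter> ?D2))"
    unfolding Int by (rule rank_surj_proj_restrict[OF S F(3) eM]) (use e in auto)
  have res: "restrict ?S ?D1 = si_contract (restrict M E1) e"
    using si_contract_restrict[OF S F(1) e(1)] by simp
  have ME: "ME ?S"
  \<comment> \<open>The projected parts may fail to be proper: if \<open>E2\<close> already projects
    onto everything, the contraction is a copy of \<open>restrict M E2\<close> rather than a modular
    join.\<close>
  proof (cases "?D2 = ground ?S")
    case True
    then show ?thesis using rank_surj_ME[OF ME2 g2] by simp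
  next
    case False
    have "?D1 \<noteq> ground ?S"
    proof
      assume "?D1 = ground ?S"
      then have "?D2 \<subseteq> ?D1" using ground by auto
      then have "E2 \<subseteq> E1" using rank_surj_flat_subset[OF f FE sub] by auto
      then show False using ne E by auto
    qed
    then have "modular_join ?S ?D1 ?D2" using SS ground D False by (simp add: modular_join_def)
    moreover have "round_flat ?S (?D1 \<inter> ?D2)"
      using rank_surj_round[OF gW] W flat_Int[OF MS] D modular_flatD[OF MS] by (simp add: round_flat_def)
    ultimately show ?thesis using ME.join[of ?S ?D1 ?D2] res div(2) rank_surj_ME[OF ME2 g2] by simp
  qed
  let ?w = "char_poly (restrict M (E1 \<inter> E2))" and ?c = "char_poly (contract M e)"
  note MR = matroid_restrict[OF M flat_subset]
  have "?c * ?w = char_poly (contract (restrict M E1) e) * char_poly (restrict M E2)"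
    using char_poly_modular_Un[OF MS D ground] rank_surj_char_poly[OF MR[OF F(3)] gW]
      rank_surj_char_poly[OF MR[OF F(2)] g2] res char_poly_si_contract[OF S eM]
      char_poly_si_contract[OF simple_restrict[OF S flat_subset[OF F(1)]], of e] e by simp
  moreover have "char_poly (contract (restrict M E1) e) dvd char_poly (restrict M E1)"
    using div(1) by (simp add: divisional_atom_def)
  \<comment> \<open>Divisibility is first shown after multiplying by the polynomial
    \<open>?w\<close> of the common flat, which is nonzero and is then cancelled.\<close>
  ultimately have "?c * ?w dvd char_poly M * ?w"
    unfolding char_poly_modular_Un[OF M E(2,3,1)] by (simp add: mult_dvd_mono)
  then have "?c dvd char_poly M" using char_poly_nonzero[OF MR[OF F(3)]] by simp
  then show ?thesis using ME eM by (simp add: divisional_atom_def)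
qed

section \<open>Induction on the construction of the class\<close>

lemma round_flat_cases:
  assumes M: "matroid M" and X: "round_flat M X" and E: "flat M E1" "flat M E2" "X \<subseteq> E1 \<union> E2"
  shows "X \<subseteq> E1 \<or> X \<subseteq> E2"
proof -
  have FX: "flat M X" "round_matroid (restrict M X)" using X by (auto simp: round_flat_def)
  have "flat (restrict M X) (E1 \<inter> X)" "flat (restrict M X) (E2 \<inter> X)"
    using flat_restrict[OF M] E FX by auto
  moreover have "E1 \<inter> X \<union> E2 \<inter> X = ground (restrict M X)" using E by auto
  ultimately have "E1 \<inter> X = X \<or> E2 \<inter> X = X" using FX(2) unfolding round_matroid_def by auto
  then show ?thesis by auto
qed

lemma round_flat_restrict:
  assumes "matroid M" "flat M Y" "round_flat M X" "X \<subseteq> Y"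
  shows "round_flat (restrict M Y) X"
  using assms by (simp add: round_flat_def flat_restrict_iff)

text \<open>The flat \<open>X\<close> controls the position of \<open>e\<close>: a modular join
  needs an atom of one part outside the common flat, and a coatom that covers the ground set
  together with \<open>X\<close> needs an atom whose projection keeps the points outside the coatom
  distinct.\<close>

lemma ME_divisional_outside_round:
  assumes "ME M" "round_flat M X" "X \<noteq> ground M"
  shows "\<exists>e. e \<notin> X \<and> divisional_atom M e \<and> ME (si_contract M e)"
  using assms
proof (induction M arbitrary: X rule: ME.induct)
  case (empty M)
  then show ?case using flat_subset by (auto simp: round_flat_def)
next
  case (coatom M Y)
  note S = coatom.hyps(1) and Y = coatom.hyps(2,3)
  note M = simple_matroidD(1)[OF S]
  have FY: "flat M Y" "Y \<subseteq> ground M" using modular_flatD[OF M Y(1)] flat_subset by auto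
  have FX: "flat M X" "X \<subseteq> ground M" using coatom.prems(1) flat_subset by (auto simp: round_flat_def)
  show ?case
  proof (cases "ground M = X \<union> Y")
    case False
    then obtain e where "e \<in> ground M" "e \<notin> X" "e \<notin> Y" using FX FY by auto
    then show ?thesis using divisional_outside_coatom[OF S Y coatom.hyps(4)] by blast
  next
    case True
    have "\<not> X \<subseteq> Y"
    proof
      assume "X \<subseteq> Y"
      then have "Y = ground M" using True by auto
      then show False using Y(2) by (simp add: coatom_def)
    qed
    then have "round_flat (restrict M Y) (X \<inter> Y)"
      using round_flat_Int_modular_coatom[OF S Y coatom.prems(1)]
      by (intro round_flat_restrict[OF M FY(1)]) auto
    \<comment> \<open>If \<open>Y\<close> were contained in \<open>X\<close>, the cover by
      \<open>X\<close> and \<open>Y\<close> would make \<open>X\<close> the whole ground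
      set.\<close>
    moreover have "X \<inter> Y \<noteq> ground (restrict M Y)" using True coatom.prems(2) by auto
    ultimately obtain e where e: "e \<notin> X \<inter> Y" "divisional_atom (restrict M Y) e"
        "ME (si_contract (restrict M Y) e)"
      using coatom.IH by blast
    then have "e \<in> Y" by (simp add: divisional_atom_def)
    then show ?thesis using divisional_inside_coatom[OF S Y FX(1) True _ _ e(2,3)] e(1) by auto
  qed
next
  case (join M E1 E2)
  have S: "simple_matroid M" and E: "ground M = E1 \<union> E2" "modular_flat M E1" "modular_flat M E2"
    and ne: "E1 \<noteq> ground M" "E2 \<noteq> ground M"
    using join.hyps(1) by (auto simp: modular_join_def)
  note M = simple_matroidD(1)[OF S]
  have F: "flat M E1" "flat M E2" using E modular_flatD[OF M] by blast+
  have sym: "modular_join M E2 E1" "round_flat M (E2 \<inter> E1)"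
    using join.hyps(1,2) by (auto simp: modular_join_def Un_commute Int_commute)
  have "X \<subseteq> E1 \<union> E2" using join.prems(1) E flat_subset by (auto simp: round_flat_def)
  then consider "X \<subseteq> E2" | "X \<subseteq> E1" using round_flat_cases[OF M join.prems(1) F] by auto
  then show ?case
  proof cases
    case 1
    \<comment> \<open>The induction hypothesis is applied to the common flat instead of
      \<open>X\<close>: an atom of \<open>E1\<close> outside it is outside \<open>E2\<close>, hence
      outside \<open>X\<close>.\<close>
    have "round_flat (restrict M E1) (E1 \<inter> E2)" "E1 \<inter> E2 \<noteq> ground (restrict M E1)"
      using round_flat_restrict[OF M F(1) join.hyps(2)] ne E by auto
    then obtain e where e: "e \<notin> E1 \<inter> E2" "divisional_atom (restrict M E1) e"
        "ME (si_contract (restrict M E1) e)"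
      using join.IH(1) by blast
    then have "e \<in> E1" by (simp add: divisional_atom_def)
    then show ?thesis
      using divisional_modular_join[OF join.hyps(1,2,4) _ _ e(2,3)] e(1) 1 by auto
  next
    case 2
    have "round_flat (restrict M E2) (E2 \<inter> E1)" "E2 \<inter> E1 \<noteq> ground (restrict M E2)"
      using round_flat_restrict[OF M F(2) sym(2)] ne E by auto
    then obtain e where e: "e \<notin> E2 \<inter> E1" "divisional_atom (restrict M E2) e"
        "ME (si_contract (restrict M E2) e)"
      using join.IH(2) by blast
    then have "e \<in> E2" by (simp add: divisional_atom_def)
    then show ?thesis
      using divisional_modular_join[OF sym join.hyps(3) _ _ e(2,3)] e(1) 2 by auto
  qed
qed

theorem theorem3p2:
  fixes M :: "'a matroid"
  assumes "simple_matroid M" and "ME M" and "ground M \<noteq> {}"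
  shows "\<exists>e. divisional_atom M e \<and> ME (si (contract M e))"
proof -
  have "flat M {}" using flat_cl[OF simple_matroidD(1)[OF assms(1)], of "{}"] assms(1) by simp
  \<comment> \<open>The empty matroid has no proper flat, so it is vacuously round.\<close>
  moreover have "round_matroid (restrict M {})"
    using flat_subset[of "restrict M {}"] by (auto simp: round_matroid_def)
  ultimately have "round_flat M {}" by (simp add: round_flat_def)
  then show ?thesis using ME_divisional_outside_round[OF assms(2)] assms(3) by blast
qed

end
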